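(* Let $(\lambda,k)\in\sigma_D\times\mathbb Z_N$ and let $\mathcal H_k(\lambda)=\{\psi\in\mathfrak D(H_k):H_k\psi=\lambda\psi\}$. (i) Every eigenfunction in $\mathcal H_k(\lambda)$ vanishes at all vertices of $\Gamma^1$. (ii) Let $\varphi=\varphi(\cdot,\lambda)|_{[0,1]}$, $c=\varphi'(1,\lambda)$, $\eta=1-s^kc^2$. Define $\psi^{(0)}=(\psi^{(0)}_\alpha)_{\alpha\in\mathbb Z\times\{0,1,2\}}$ as follows. If $\eta\neq0$: $\psi^{(0)}_{n,j}=0$ for all $n\ne0,-1$ and $j\in\{0,1,2\}$, and $$\psi^{(0)}_{0,0}=\eta\varphi,\ \psi^{(0)}_{0,1}=c\varphi,\ \psi^{(0)}_{0,2}=c^2\varphi,\ \psi^{(0)}_{-1,0}=0,\ \psi^{(0)}_{-1,1}=-s^kc\varphi,\ \psi^{(0)}_{-1,2}=-\varphi .$$ If $\eta=0$: $\psi^{(0)}_{0,0}=0$, $\psi^{(0)}_{0,1}=\varphi$, $\psi^{(0)}_{0,2}=c\varphi$, and $\psi^{(0)}_{n,j}=0$ for all $n\neq0$, $j\in\{0,1,2\}$. For $n\in\mathbb Z$ let $\psi^{(n)}=(\psi^{(0)}_{p-n,j})_{(p,j)\in\mathbb Z\times\{0,1,2\}}$. Then each $\psi^{(n)}\in\mathcal H_k(\lambda)$, and each $f\in\mathcal H_k(\lambda)$ has the form $$f=\sum_{n\in\mathbb Z}\widehat f_n\psi^{(n)},\qquad \widehat f_n=\begin{cases}\eta^{-1}f'_{n,0}(0)&\text{if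 }\eta\neq0,\\ f'_{n,1}(0)&\text{if }\eta=0,\end{cases}\qquad (\widehat f_n)_{n\in\mathbb Z}\in\ell^2 .$$ Moreover the map $f\mapsto(\widehat f_n)_{n\in\mathbb Z}$ is a linear isomorphism between $\mathcal H_k(\lambda)$ and $\ell^2(\mathbb Z)$.
   Context: Fix an integer $m\ge0$, $N=2m+1$, $s=e^{2\pi i/N}$, and a real-valued $q\in L^2(0,1)$. Let $\varphi(x,\lambda)$ be the solution of $-y''+qy=\lambda y$ with $\varphi(0,\lambda)=0$, $\varphi'(0,\lambda)=1$, and $\sigma_D=\{\lambda:\varphi(1,\lambda)=0\}$ (Dirichlet spectrum on $[0,1]$). Graph $\Gamma^1$: edges $\Gamma_{n,j}$, $(n,j)\in\mathbb Z\times\{0,1,2\}$, each identified with $[0,1]$; its vertices are, for each $n\in\mathbb Z$, the point joining the end $t=1$ of $\Gamma_{n,0}$, the end $t=0$ of $\Gamma_{n,1}$ and the end $t=1$ of $\Gamma_{n,2}$, and the point joining the end $t=0$ of $\Gamma_{n+1,0}$, the end $t=1$ of $\Gamma_{n,1}$ and the end $t=0$ of $\Gamma_{n,2}$. For $k\in\mathbb Z_N$ the self-adjoint operator $H_k$ in $L^2(\Gamma^1)=\bigoplus L^2(0,1)$ acts by $(H_kf)_\alpha=-f_\alpha''+qf_\alpha$ on the domain $\mathfrak D(H_k)$ of $f\in L^2(\Gamma^1)$ with $f_\alpha\in W^{2,2}(0,1)$, $(f_\alpha'')\in L^2(\Gamma^1)$ and, for all $n\in\mathbb Z$: $f_{n,0}(1)=f_{n,1}(0)=s^kf_{n,2}(1)$,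 $f_{n+1,0}(0)=f_{n,1}(1)=f_{n,2}(0)$, $-f'_{n,0}(1)+f'_{n,1}(0)-s^kf'_{n,2}(1)=0$, $f'_{n+1,0}(0)-f'_{n,1}(1)+f'_{n,2}(0)=0$. *)

theory Defs
  imports "HOL-Analysis.Analysis"
begin

datatype ej = J0 | J1 | J2

definition dv :: "(real \<Rightarrow> 'a::real_normed_vector) \<Rightarrow> real \<Rightarrow> 'a" where
  "dv y x = vector_derivative y (at x within {0..1})"

text \<open>Solution (in the Caratheodory / W^{2,1} sense) of  -y'' + q y = lam y  on [0,1]:
  y is differentiable on [0,1] and y' is the indefinite integral of (q - lam) y.\<close>
definition sl_solution :: "(real \<Rightarrow> real) \<Rightarrow> real \<Rightarrow> (real \<Rightarrow> real) \<Rightarrow> bool" where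
  "sl_solution q lam y \<longleftrightarrow>
     (\<forall>x\<in>{0..1}. (y has_vector_derivative dv y x) (at x within {0..1})) \<and>
     (\<forall>x\<in>{0..1}. dv y x = dv y 0 + integral {0..x} (\<lambda>t. (q t - lam) * y t))"

definition phi :: "(real \<Rightarrow> real) \<Rightarrow> real \<Rightarrow> real \<Rightarrow> real" where
  "phi q lam = (THE y. sl_solution q lam y \<and> y 0 = 0 \<and> dv y 0 = 1 \<and> (\<forall>x. x \<notin> {0..1} \<longrightarrow> y x = 0))"

definition sigma_D :: "(real \<Rightarrow> real) \<Rightarrow> real set" where
  "sigma_D q = {lam. phi q lam 1 = 0}"

definition L2_01 :: "(real \<Rightarrow> real) \<Rightarrow> bool" where
  "L2_01 q \<longleftrightarrow> q \<in> borel_measurable lborel \<and> set_integrable lborel {0..1} (\<lambda>x. (q x)^2)"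

definition sN :: "nat \<Rightarrow> complex" where
  "sN m = cis (2 * pi / real (2 * m + 1))"

text \<open>y in W^{2,2}(0,1) with (weak) second derivative g in L^2(0,1).\<close>
definition W22 :: "(real \<Rightarrow> complex) \<Rightarrow> (real \<Rightarrow> complex) \<Rightarrow> bool" where
  "W22 y g \<longleftrightarrow>
     (\<forall>x\<in>{0..1}. (y has_vector_derivative dv y x) (at x within {0..1})) \<and>
     g \<in> borel_measurable lborel \<and>
     set_integrable lborel {0..1} g \<and>
     set_integrable lborel {0..1} (\<lambda>x. (cmod (g x))^2) \<and>
     (\<forall>x\<in>{0..1}. dv y x = dv y 0 + integral {0..x} g)"

text \<open>Functions on the graph Gamma^1: f n j is the component on edge Gamma_{n,j}, identified
  with [0,1]; as a normalisation, components vanish outside [0,1].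
  Membership in L^2(Gamma^1).\<close>
definition L2_graph :: "(int \<Rightarrow> ej \<Rightarrow> real \<Rightarrow> complex) \<Rightarrow> bool" where
  "L2_graph f \<longleftrightarrow>
     (\<forall>n j. set_integrable lborel {0..1} (\<lambda>x. (cmod (f n j x))^2)) \<and>
     ((\<lambda>(n, j). LINT x:{0..1}|lborel. (cmod (f n j x))^2) summable_on UNIV)"

definition vertex_conds :: "nat \<Rightarrow> nat \<Rightarrow> (int \<Rightarrow> ej \<Rightarrow> real \<Rightarrow> complex) \<Rightarrow> bool" where
  "vertex_conds m k f \<longleftrightarrow> (\<forall>n::int.
     f n J0 1 = f n J1 0 \<and> f n J1 0 = sN m ^ k * f n J2 1 \<and>
     f (n + 1) J0 0 = f n J1 1 \<and> f n J1 1 = f n J2 0 \<and>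
     - dv (f n J0) 1 + dv (f n J1) 0 - sN m ^ k * dv (f n J2) 1 = 0 \<and>
     dv (f (n + 1) J0) 0 - dv (f n J1) 1 + dv (f n J2) 0 = 0)"

definition dom_H :: "nat \<Rightarrow> nat \<Rightarrow> (int \<Rightarrow> ej \<Rightarrow> real \<Rightarrow> complex) set" where
  "dom_H m k = {f. (\<forall>n j x. x \<notin> {0..1} \<longrightarrow> f n j x = 0) \<and> L2_graph f \<and>
     (\<exists>g. (\<forall>n j. W22 (f n j) (g n j)) \<and> L2_graph (\<lambda>n j x. indicator {0..1} x * g n j x)) \<and>
     vertex_conds m k f}"

definition eigsp :: "(real \<Rightarrow> real) \<Rightarrow> nat \<Rightarrow> nat \<Rightarrow> real \<Rightarrow> (int \<Rightarrow> ej \<Rightarrow> real \<Rightarrow> complex) set" where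
  "eigsp q m k lam = {f \<in> dom_H m k.
     \<exists>g. (\<forall>n j. W22 (f n j) (g n j)) \<and>
         (\<forall>n j. AE x in lborel. x \<in> {0..1} \<longrightarrow>
             - g n j x + complex_of_real (q x) * f n j x = complex_of_real lam * f n j x)}"

definition cc :: "(real \<Rightarrow> real) \<Rightarrow> real \<Rightarrow> real" where
  "cc q lam = dv (phi q lam) 1"

definition eta :: "(real \<Rightarrow> real) \<Rightarrow> nat \<Rightarrow> nat \<Rightarrow> real \<Rightarrow> complex" where
  "eta q m k lam = 1 - sN m ^ k * complex_of_real (cc q lam) ^ 2"

definition psi0 :: "(real \<Rightarrow> real) \<Rightarrow> nat \<Rightarrow> nat \<Rightarrow> real \<Rightarrow> int \<Rightarrow> ej \<Rightarrow> real \<Rightarrow> complex" where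
  "psi0 q m k lam n j x =
     (let ph = complex_of_real (phi q lam x); c = complex_of_real (cc q lam);
          e = eta q m k lam; sk = sN m ^ k in
      if e \<noteq> 0 then
        (if n = 0 then (case j of J0 \<Rightarrow> e * ph | J1 \<Rightarrow> c * ph | J2 \<Rightarrow> c^2 * ph)
         else if n = -1 then (case j of J0 \<Rightarrow> 0 | J1 \<Rightarrow> - sk * c * ph | J2 \<Rightarrow> - ph)
         else 0)
      else
        (if n = 0 then (case j of J0 \<Rightarrow> 0 | J1 \<Rightarrow> ph | J2 \<Rightarrow> c * ph) else 0))"

definition psi :: "(real \<Rightarrow> real) \<Rightarrow> nat \<Rightarrow> nat \<Rightarrow> real \<Rightarrow> int \<Rightarrow> int \<Rightarrow> ej \<Rightarrow> real \<Rightarrow> complex" where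
  "psi q m k lam n p j x = psi0 q m k lam (p - n) j x"

definition fhat :: "(real \<Rightarrow> real) \<Rightarrow> nat \<Rightarrow> nat \<Rightarrow> real \<Rightarrow> (int \<Rightarrow> ej \<Rightarrow> real \<Rightarrow> complex) \<Rightarrow> int \<Rightarrow> complex" where
  "fhat q m k lam f n =
     (if eta q m k lam \<noteq> 0 then dv (f n J0) 0 / eta q m k lam else dv (f n J1) 0)"

definition l2Z :: "(int \<Rightarrow> complex) set" where
  "l2Z = {a. (\<lambda>n. (cmod (a n))^2) summable_on UNIV}"

end

theory Submission
  imports Defs
begin

text \<open>Since \<open>\<phi>(1) = 0\<close>, every solution \<open>y\<close> of the equation satisfies \<open>y(1) = r y(0)\<close> with
  \<open>r = \<theta>(1)\<close>, where \<open>\<theta>\<close> is the solution with \<open>\<theta>(0) = 1\<close>, \<open>\<theta>'(0) = 0\<close>. Continuity at the vertices then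
  makes the values \<open>v\<^sub>n = f\<^bsub>n,1\<^esub>(0)\<close> satisfy \<open>v\<^bsub>n+1\<^esub> = r\<^sup>2 v\<^sub>n\<close> and \<open>v\<^sub>n = s\<^sup>k r\<^sup>2 v\<^sub>n\<close>; a nonzero \<open>v\<^sub>n\<close> forces
  \<open>r\<^sup>2 = 1\<close>, so \<open>v\<close> is constant and \<open>f\<close> is not square integrable. Hence \<open>f\<^bsub>n,j\<^esub> = b\<^bsub>n,j\<^esub> \<phi>\<close>, and the
  Kirchhoff conditions become linear recurrences for \<open>b\<close>, whose \<open>\<ell>\<^sup>2\<close> solutions are the combinations
  \<open>b\<^bsub>n,j\<^esub> = a\<^sub>n \<beta>\<^bsub>0,j\<^esub> + a\<^bsub>n+1\<^esub> \<beta>\<^bsub>1,j\<^esub>\<close> with \<open>a \<in> \<ell>\<^sup>2\<close>. When \<open>\<eta> = 0\<close> one has \<open>s\<^sup>k = c\<^sup>2 = 1\<close>, and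
  \<open>b\<^bsub>n,0\<^esub>\<close> is constant in \<open>n\<close>, hence zero. The solutions \<open>\<phi>\<close> and \<open>\<theta>\<close> come from Picard iteration, whose
  factorial bounds also give uniqueness.\<close>

section \<open>The initial value problem\<close>

text \<open>A solution of \<open>u'' = Q u\<close> is a solution of \<open>u(x) = u(0) + x u'(0) + volterra Q u x\<close>.\<close>
definition volterra :: "(real \<Rightarrow> real) \<Rightarrow> (real \<Rightarrow> 'a::euclidean_space) \<Rightarrow> real \<Rightarrow> 'a" where
  "volterra Q w x = integral {0..x} (\<lambda>s. integral {0..s} (\<lambda>t. Q t *\<^sub>R w t))"

section \<open>Estimates for the Volterra operator and Picard iteration\<close>

lemma absolutely_integrable_scaleR_continuous:
  fixes w :: "real \<Rightarrow> 'a::euclidean_space"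
  assumes Q: "Q absolutely_integrable_on {0..1}" and w: "continuous_on {0..1} w" and x: "x \<le> (1::real)"
  shows "(\<lambda>t. Q t *\<^sub>R w t) absolutely_integrable_on {0..x}"
proof -
  \<comment> \<open>The product rule for integrability takes the bounded measurable factor first,
    hence the swapped arguments.\<close>
  have bl: "bilinear (\<lambda>w (q::real). q *\<^sub>R (w::'a))"
    by (simp add: bilinear_def linear_iff algebra_simps)
  have "w \<in> borel_measurable (lebesgue_on {0..1})"
    by (intro continuous_imp_measurable_on_sets_lebesgue w) auto
  moreover have "bounded (w ` {0..1})"
    by (intro compact_imp_bounded compact_continuous_image w) auto
  ultimately have "(\<lambda>t. Q t *\<^sub>R w t) absolutely_integrable_on {0..1}"
    using absolutely_integrable_bounded_measurable_product[OF bl, of w "{0..1}" Q] Q by simp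
  then show ?thesis
    by (rule absolutely_integrable_on_subinterval) (use x in auto)
qed

lemma norm_integral_scaleR_le:
  fixes w :: "real \<Rightarrow> 'a::euclidean_space"
  assumes Q: "Q absolutely_integrable_on {0..1}" and w: "continuous_on {0..1} w"
    and x: "0 \<le> x" "x \<le> (1::real)" and C: "\<And>t. t \<in> {0..x} \<Longrightarrow> norm (w t) \<le> C"
  shows "norm (integral {0..x} (\<lambda>t. Q t *\<^sub>R w t)) \<le> integral {0..1} (\<lambda>t. \<bar>Q t\<bar>) * C"
proof -
  have Q01: "(\<lambda>t. \<bar>Q t\<bar>) integrable_on {0..1}"
    using Q by (simp add: absolutely_integrable_on_def)
  then have Qx: "(\<lambda>t. \<bar>Q t\<bar>) integrable_on {0..x}"
    by (rule integrable_subinterval_real) (use x in auto)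
  have C0: "0 \<le> C" using order_trans[OF norm_ge_zero C[of 0]] x by simp
  have "norm (integral {0..x} (\<lambda>t. Q t *\<^sub>R w t)) \<le> integral {0..x} (\<lambda>t. \<bar>Q t\<bar> * C)"
  proof (rule integral_norm_bound_integral)
    show "(\<lambda>t. Q t *\<^sub>R w t) integrable_on {0..x}"
      using absolutely_integrable_scaleR_continuous[OF Q w x(2)]
      by (rule set_lebesgue_integral_eq_integral)
    show "(\<lambda>t. \<bar>Q t\<bar> * C) integrable_on {0..x}"
      using Qx by (rule integrable_on_mult_left)
    show "norm (Q t *\<^sub>R w t) \<le> \<bar>Q t\<bar> * C" if "t \<in> {0..x}" for t
      using C[OF that] by (simp add: mult_left_mono)
  qed
  also have "\<dots> = integral {0..x} (\<lambda>t. \<bar>Q t\<bar>) * C" by simp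
  also have "\<dots> \<le> integral {0..1} (\<lambda>t. \<bar>Q t\<bar>) * C"
    by (intro mult_right_mono integral_subset_le Qx Q01 C0) (use x in auto)
  finally show ?thesis .
qed

lemma volterra_inner_continuous:
  fixes w :: "real \<Rightarrow> 'a::euclidean_space"
  assumes "Q absolutely_integrable_on {0..1}" "continuous_on {0..1} w"
  shows "continuous_on {0..1} (\<lambda>s. integral {0..s} (\<lambda>t. Q t *\<^sub>R w t))"
  using absolutely_integrable_scaleR_continuous[OF assms order_refl]
  by (intro indefinite_integral_continuous_1 set_lebesgue_integral_eq_integral)

text \<open>The inner integral is continuous although \<open>Q\<close> is only integrable, so the
  fundamental theorem of calculus applies at every point, not just almost everywhere.\<close>

lemma volterra_has_vector_derivative:
  fixes w :: "real \<Rightarrow> 'a::euclidean_space"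
  assumes "Q absolutely_integrable_on {0..1}" "continuous_on {0..1} w" "x \<in> {0..1}"
  shows "(volterra Q w has_vector_derivative integral {0..x} (\<lambda>t. Q t *\<^sub>R w t)) (at x within {0..1})"
  unfolding volterra_def[abs_def]
  by (intro integral_has_vector_derivative volterra_inner_continuous assms)

lemma volterra_continuous:
  fixes w :: "real \<Rightarrow> 'a::euclidean_space"
  assumes "Q absolutely_integrable_on {0..1}" "continuous_on {0..1} w"
  shows "continuous_on {0..1} (volterra Q w)"
  unfolding continuous_on_eq_continuous_within
  using volterra_has_vector_derivative[OF assms] has_vector_derivative_continuous by blast

lemma volterra_diff:
  fixes w z :: "real \<Rightarrow> 'a::euclidean_space"
  assumes Q: "Q absolutely_integrable_on {0..1}" and w: "continuous_on {0..1} w"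
    and z: "continuous_on {0..1} z" and x: "x \<le> (1::real)"
  shows "volterra Q (\<lambda>t. w t - z t) x = volterra Q w x - volterra Q z x"
proof -
  have int: "(\<lambda>s. integral {0..s} (\<lambda>t. Q t *\<^sub>R v t)) integrable_on {0..x}"
    if "continuous_on {0..1} v" for v :: "real \<Rightarrow> 'a"
    by (intro integrable_continuous_real continuous_on_subset[OF volterra_inner_continuous[OF Q that]])
      (use x in auto)
  have "integral {0..s} (\<lambda>t. Q t *\<^sub>R (w t - z t)) =
      integral {0..s} (\<lambda>t. Q t *\<^sub>R w t) - integral {0..s} (\<lambda>t. Q t *\<^sub>R z t)" if "s \<in> {0..x}" for s
    using that x absolutely_integrable_scaleR_continuous[OF Q w, of s]
      absolutely_integrable_scaleR_continuous[OF Q z, of s]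
    by (simp add: scaleR_diff_right integral_diff set_lebesgue_integral_eq_integral(1))
  then have "volterra Q (\<lambda>t. w t - z t) x = integral {0..x} (\<lambda>s.
      integral {0..s} (\<lambda>t. Q t *\<^sub>R w t) - integral {0..s} (\<lambda>t. Q t *\<^sub>R z t))"
    unfolding volterra_def by (intro integral_cong)
  also have "\<dots> = volterra Q w x - volterra Q z x"
    unfolding volterra_def by (intro integral_diff int w z)
  finally show ?thesis .
qed

text \<open>Inductive step of the Picard estimate: the inner integral costs a factor
  \<open>K\<close>, and the outer integration raises the power of \<open>t\<close> and supplies the
  next factor of the factorial.\<close>

lemma norm_volterra_le:
  fixes w :: "real \<Rightarrow> 'a::euclidean_space"
  assumes Q: "Q absolutely_integrable_on {0..1}" and w: "continuous_on {0..1} w"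
    and K: "K = integral {0..1} (\<lambda>t. \<bar>Q t\<bar>)"
    and bd: "\<And>t. t \<in> {0..1} \<Longrightarrow> norm (w t) \<le> C * ((K * t) ^ n / fact n)"
    and x: "x \<in> {0..1}" and C: "0 \<le> C"
  shows "norm (volterra Q w x) \<le> C * ((K * x) ^ Suc n / fact (Suc n))"
proof -
  have K0: "0 \<le> K" unfolding K by (intro integral_nonneg) (use Q in \<open>auto simp: absolutely_integrable_on_def\<close>)
  have hd: "((\<lambda>s. C * ((K * s) ^ Suc n / fact (Suc n))) has_vector_derivative
      K * (C * ((K * s) ^ n / fact n))) (at s within {0..x})" for s
  proof -
    define A where "A = C * K ^ Suc n / fact (Suc n)"
    have "((\<lambda>s. A * s ^ Suc n) has_real_derivative A * (real (Suc n) * s ^ n)) (at s within {0..x})"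
      using DERIV_cmult[OF DERIV_pow[of "Suc n" s "{0..x}"]] by simp
    moreover have "A * (real (Suc n) * s ^ n) = K * (C * ((K * s) ^ n / fact n))"
      unfolding A_def fact_Suc by (simp add: power_mult_distrib del: of_nat_Suc)
    moreover have "(\<lambda>s. A * s ^ Suc n) = (\<lambda>s. C * ((K * s) ^ Suc n / fact (Suc n)))"
      by (simp only: A_def power_mult_distrib times_divide_eq_left times_divide_eq_right mult.assoc)
    ultimately show ?thesis
      unfolding has_real_derivative_iff_has_vector_derivative[symmetric] by simp
  qed
  have hi: "((\<lambda>s. K * (C * ((K * s) ^ n / fact n))) has_integral
      (C * ((K * x) ^ Suc n / fact (Suc n)) - C * ((K * 0) ^ Suc n / fact (Suc n)))) {0..x}"
    by (intro fundamental_theorem_of_calculus hd) (use x in auto)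
  have "norm (volterra Q w x) \<le> integral {0..x} (\<lambda>s. K * (C * ((K * s) ^ n / fact n)))"
    unfolding volterra_def
  proof (rule integral_norm_bound_integral)
    show "(\<lambda>s. integral {0..s} (\<lambda>t. Q t *\<^sub>R w t)) integrable_on {0..x}"
      by (intro integrable_continuous_real continuous_on_subset[OF volterra_inner_continuous[OF Q w]])
        (use x in auto)
    show "(\<lambda>s. K * (C * ((K * s) ^ n / fact n))) integrable_on {0..x}"
      using hi by blast
    fix s assume s: "s \<in> {0..x}"
    show "norm (integral {0..s} (\<lambda>t. Q t *\<^sub>R w t)) \<le> K * (C * ((K * s) ^ n / fact n))"
      unfolding K
    proof (rule norm_integral_scaleR_le[OF Q w])
      fix t assume t: "t \<in> {0..s}"
      have "norm (w t) \<le> C * ((K * t) ^ n / fact n)" using bd t s x by auto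
      also have "\<dots> \<le> C * ((K * s) ^ n / fact n)"
        using t K0 C by (intro mult_left_mono divide_right_mono power_mono) auto
      finally show "norm (w t) \<le> C * ((integral {0..1} (\<lambda>t. \<bar>Q t\<bar>) * s) ^ n / fact n)"
        by (simp add: K)
    qed (use s x in auto)
  qed
  also have "\<dots> = C * ((K * x) ^ Suc n / fact (Suc n))"
    using integral_unique[OF hi] by simp
  finally show ?thesis .
qed

text \<open>A fixed point satisfies the Picard bound for every \<open>n\<close>, and
  \<open>(K * x) ^ n / fact n\<close> tends to 0.\<close>

lemma volterra_fixed_point_zero:
  fixes u :: "real \<Rightarrow> 'a::euclidean_space"
  assumes Q: "Q absolutely_integrable_on {0..1}" and u: "continuous_on {0..1} u"
    and fp: "\<And>x. x \<in> {0..1} \<Longrightarrow> u x = volterra Q u x" and x: "x \<in> {0..1}"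
  shows "u x = 0"
proof -
  define K where "K = integral {0..1} (\<lambda>t. \<bar>Q t\<bar>)"
  have "bounded (u ` {0..1})"
    by (intro compact_imp_bounded compact_continuous_image u) auto
  then obtain C where C: "0 < C" "\<And>t. t \<in> {0..1} \<Longrightarrow> norm (u t) \<le> C"
    by (auto simp: bounded_pos)
  have bd: "norm (u t) \<le> C * ((K * t) ^ n / fact n)" if "t \<in> {0..1}" for n t
    using that
  proof (induction n arbitrary: t)
    case (Suc n)
    then show ?case
      using norm_volterra_le[OF Q u K_def, of C n t] C(1) fp[of t] by simp
  qed (use C in auto)
  have "(\<lambda>n. C * ((K * x) ^ n / fact n)) \<longlonglongrightarrow> C * 0"
    using summable_LIMSEQ_zero[OF summable_exp[of "K * x"]]
    by (intro tendsto_intros) (simp add: field_simps)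
  then have "norm (u x) \<le> 0"
    using bd[OF x] by (intro Lim_bounded2[of _ "0" 0]) auto
  then show ?thesis by simp
qed

text \<open>The solution is the Neumann series, the sum of all iterates of \<open>volterra Q\<close>
  applied to \<open>w\<close>.\<close>

lemma volterra_solution_exists:
  fixes w :: "real \<Rightarrow> 'a::euclidean_space"
  assumes Q: "Q absolutely_integrable_on {0..1}" and w: "continuous_on {0..1} w"
  obtains u where "continuous_on {0..1} u" "\<And>x. x \<in> {0..1} \<Longrightarrow> u x = w x + volterra Q u x"
proof -
  define K where "K = integral {0..1} (\<lambda>t. \<bar>Q t\<bar>)"
  have K0: "0 \<le> K" unfolding K_def by (intro integral_nonneg) (use Q in \<open>auto simp: absolutely_integrable_on_def\<close>)
  define f where "f n = (volterra Q ^^ n) w" for n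
  have f_Suc: "f (Suc n) = volterra Q (f n)" for n by (simp add: f_def)
  have f_cont: "continuous_on {0..1} (f n)" for n
    by (induction n) (use w volterra_continuous[OF Q] in \<open>auto simp: f_def\<close>)
  have "bounded (w ` {0..1})"
    by (intro compact_imp_bounded compact_continuous_image w) auto
  then obtain C where C: "0 < C" "\<And>t. t \<in> {0..1} \<Longrightarrow> norm (w t) \<le> C"
    by (auto simp: bounded_pos)
  have bd: "norm (f n t) \<le> C * ((K * t) ^ n / fact n)" if "t \<in> {0..1}" for n t
    using that
  proof (induction n arbitrary: t)
    case (Suc n)
    then show ?case
      using norm_volterra_le[OF Q f_cont K_def, of n C n t] C(1) by (simp add: f_Suc)
  qed (use C in \<open>auto simp: f_def\<close>)
  \<comment> \<open>The Weierstrass test needs a majorant that does not depend on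
    \<open>t\<close>.\<close>
  have bd': "norm (f n t) \<le> C * (K ^ n / fact n)" if "t \<in> {0..1}" for n t
  proof -
    have "(K * t) ^ n \<le> K ^ n" using that K0 by (intro power_mono) (auto simp: mult_left_le)
    then have "C * ((K * t) ^ n / fact n) \<le> C * (K ^ n / fact n)"
      using C(1) by (intro mult_left_mono divide_right_mono) auto
    with bd[OF that, of n] show ?thesis by linarith
  qed
  define S where "S N x = (\<Sum>i<N. f i x)" for N x
  define u where "u x = (\<Sum>i. f i x)" for x
  have S_Suc: "S (Suc N) x = S N x + f N x" for N x
    by (simp add: S_def)
  have S_cont: "continuous_on {0..1} (S N)" for N
    unfolding S_def by (intro continuous_intros f_cont)
  have lim: "uniform_limit {0..1} S u sequentially"
    unfolding S_def[abs_def] u_def[abs_def]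
  proof (rule Weierstrass_m_test[OF bd'])
    show "summable (\<lambda>n. C * (K ^ n / fact n))"
      using summable_exp[of K] by (intro summable_mult) (simp add: field_simps)
  qed
  have u_cont: "continuous_on {0..1} u"
    by (rule uniform_limit_theorem[OF _ lim]) (auto intro: S_cont always_eventually)
  \<comment> \<open>Applying the operator shifts the partial sums by one index; the limit of this
    identity is the fixed point equation.\<close>
  have vS: "volterra Q (S N) x = S (Suc N) x - w x" if "x \<in> {0..1}" for N x
  proof (induction N)
    case 0
    then show ?case by (simp add: S_def f_def volterra_def)
  next
    case (Suc N)
    have "(\<lambda>t. S (Suc N) t - f N t) = S N"
      by (simp add: S_Suc fun_eq_iff)
    then have "volterra Q (S N) x = volterra Q (S (Suc N)) x - f (Suc N) x"
      using volterra_diff[OF Q S_cont f_cont, of x "Suc N" N] that by (simp add: f_Suc)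
    then show ?case using Suc S_Suc[of "Suc N" x] S_Suc[of N x] by (simp add: algebra_simps)
  qed
  have "u x = w x + volterra Q u x" if x: "x \<in> {0..1}" for x
  proof -
    have "(\<lambda>N. volterra Q (S N) x) \<longlonglongrightarrow> volterra Q u x"
    proof (rule tendstoI)
      fix e :: real assume e: "e > 0"
      \<comment> \<open>The operator enlarges a uniform bound by at most the factor \<open>K\<close>
        (the case \<open>n = 0\<close> of \<open>norm_volterra_le\<close>); \<open>K + 1\<close>
        avoids division by zero.\<close>
      define d where "d = e / (K + 1)"
      have d: "d > 0" using e K0 by (simp add: d_def)
      have "\<forall>\<^sub>F N in sequentially. \<forall>t\<in>{0..1}. dist (S N t) (u t) < d"
        using lim d by (auto simp: uniform_limit_iff)
      then show "\<forall>\<^sub>F N in sequentially. dist (volterra Q (S N) x) (volterra Q u x) < e"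
      proof eventually_elim
        case (elim N)
        have "norm (volterra Q (\<lambda>t. S N t - u t) x) \<le> d * ((K * x) ^ Suc 0 / fact (Suc 0))"
          by (rule norm_volterra_le[OF Q _ K_def])
            (use elim d x in \<open>auto intro!: continuous_intros S_cont u_cont simp: dist_norm less_imp_le\<close>)
        also have "\<dots> \<le> d * K" using x d K0 by (auto intro: mult_left_le)
        also have "\<dots> < d * (K + 1)" using d by simp
        also have "\<dots> = e" using K0 by (simp add: d_def)
        finally show ?case
          using volterra_diff[OF Q S_cont u_cont, of x N] x by (simp add: dist_norm)
      qed
    qed
    moreover have "(\<lambda>N. volterra Q (S N) x) \<longlonglongrightarrow> u x - w x"
      unfolding vS[OF x] using tendsto_uniform_limitI[OF lim x]
      by (intro tendsto_intros LIMSEQ_Suc)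
    ultimately show ?thesis using LIMSEQ_unique by fastforce
  qed
  with u_cont show ?thesis by (rule that)
qed

section \<open>Initial value problems: existence, uniqueness and linearity\<close>

lemma dv_eqI:
  assumes "(u has_vector_derivative d) (at x within {0..1})" "x \<in> {0..1}"
  shows "dv u x = d"
  using vector_derivative_within_cbox[of 0 1 x u d] assms by (simp add: dv_def)

text \<open>The equation \<open>u'' = Q u\<close> in integrated form, since \<open>Q\<close> is only
  integrable. The value type is general so that it covers both the real function \<open>phi\<close>
  and the complex components of eigenfunctions.\<close>

definition ivp :: "(real \<Rightarrow> real) \<Rightarrow> (real \<Rightarrow> 'a::euclidean_space) \<Rightarrow> bool" where
  "ivp Q u \<longleftrightarrow> (\<forall>x\<in>{0..1}. (u has_vector_derivative dv u x) (at x within {0..1}) \<and>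
     dv u x = dv u 0 + integral {0..x} (\<lambda>t. Q t *\<^sub>R u t))"

lemma ivpD:
  assumes "ivp Q u" "x \<in> {0..1}"
  shows "(u has_vector_derivative dv u x) (at x within {0..1})"
    and "dv u x = dv u 0 + integral {0..x} (\<lambda>t. Q t *\<^sub>R u t)"
  using assms by (blast dest: ivp_def[THEN iffD1])+

lemma sl_solution_iff_ivp: "sl_solution q lam y \<longleftrightarrow> ivp (\<lambda>t. q t - lam) y"
  unfolding sl_solution_def ivp_def real_scaleR_def by blast

lemma ivp_continuous: "ivp Q u \<Longrightarrow> continuous_on {0..1} u"
  unfolding continuous_on_eq_continuous_within
  using ivpD(1) has_vector_derivative_continuous by blast

text \<open>Allows the derivative to be given by an explicit candidate \<open>v\<close>, which is
  then identified with \<open>dv u\<close>.\<close>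

lemma ivpI:
  fixes u :: "real \<Rightarrow> 'a::euclidean_space"
  assumes u: "\<And>x. x \<in> {0..1} \<Longrightarrow> (u has_vector_derivative v x) (at x within {0..1})"
    and v: "\<And>x. x \<in> {0..1} \<Longrightarrow> v x = v 0 + integral {0..x} (\<lambda>t. Q t *\<^sub>R u t)"
  shows "ivp Q u" and "\<And>x. x \<in> {0..1} \<Longrightarrow> dv u x = v x"
proof -
  show *: "dv u x = v x" if "x \<in> {0..1}" for x using u that by (auto intro: dv_eqI)
  show "ivp Q u"
    unfolding ivp_def
  proof
    fix x :: real assume x: "x \<in> {0..1}"
    show "(u has_vector_derivative dv u x) (at x within {0..1}) \<and>
      dv u x = dv u 0 + integral {0..x} (\<lambda>t. Q t *\<^sub>R u t)"
      using u[OF x] v[OF x] *[OF x] *[of 0] by simp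
  qed
qed

text \<open>Integrating the formula for \<open>dv u\<close> once more gives the Volterra
  equation.\<close>

lemma ivp_volterra:
  fixes u :: "real \<Rightarrow> 'a::euclidean_space"
  assumes Q: "Q absolutely_integrable_on {0..1}" and u: "ivp Q u" and x: "x \<in> {0..1}"
  shows "u x = u 0 + x *\<^sub>R dv u 0 + volterra Q u x"
proof -
  let ?I = "\<lambda>s. integral {0..s} (\<lambda>t. Q t *\<^sub>R u t)"
  have "(dv u has_integral (u x - u 0)) {0..x}"
    using x by (intro fundamental_theorem_of_calculus
      has_vector_derivative_within_subset[OF ivpD(1)[OF u]]) auto
  then have "((\<lambda>s. dv u 0 + ?I s) has_integral (u x - u 0)) {0..x}"
    by (rule has_integral_eq[rotated]) (use x in \<open>simp flip: ivpD(2)[OF u]\<close>)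
  moreover have "((\<lambda>s. dv u 0 + ?I s) has_integral (x *\<^sub>R dv u 0 + volterra Q u x)) {0..x}"
  proof (rule has_integral_add)
    show "((\<lambda>s. dv u 0) has_integral x *\<^sub>R dv u 0) {0..x}"
      using has_integral_const_real[of "dv u 0" 0 x] x by simp
    have "?I integrable_on {0..x}"
      by (intro integrable_continuous_real
          continuous_on_subset[OF volterra_inner_continuous[OF Q ivp_continuous[OF u]]]) (use x in auto)
    then show "(?I has_integral volterra Q u x) {0..x}"
      by (simp add: volterra_def has_integral_integral)
  qed
  ultimately have "u x - u 0 = x *\<^sub>R dv u 0 + volterra Q u x" by (rule has_integral_unique)
  then show ?thesis by (simp add: algebra_simps)
qed

lemma ivp_zero:
  fixes u :: "real \<Rightarrow> 'a::euclidean_space"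
  assumes Q: "Q absolutely_integrable_on {0..1}" and u: "ivp Q u"
    and "u 0 = 0" "dv u 0 = 0" "x \<in> {0..1}"
  shows "u x = 0"
  by (rule volterra_fixed_point_zero[OF Q ivp_continuous[OF u]])
    (use ivp_volterra[OF Q u] assms in auto)

lemma ivp_exists:
  fixes a b :: "'a::euclidean_space"
  assumes Q: "Q absolutely_integrable_on {0..1}"
  obtains u where "ivp Q u" "u 0 = a" "dv u 0 = b" "\<And>x. x \<notin> {0..1} \<Longrightarrow> u x = 0"
proof -
  let ?w = "\<lambda>x::real. a + x *\<^sub>R b"
  have w: "continuous_on {0..1} ?w" by (intro continuous_intros)
  obtain z where z: "continuous_on {0..1} z" "\<And>x. x \<in> {0..1} \<Longrightarrow> z x = ?w x + volterra Q z x"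
    using volterra_solution_exists[OF Q w] by blast
  \<comment> \<open>The extension by zero matches the normalisation outside \<open>{0..1}\<close> in
    \<open>phi\<close> and \<open>dom_H\<close>.\<close>
  define u where "u x = (if x \<in> {0..1} then z x else 0)" for x
  define v where "v x = b + integral {0..x} (\<lambda>t. Q t *\<^sub>R u t)" for x
  have vz: "v x = b + integral {0..x} (\<lambda>t. Q t *\<^sub>R z t)" if "x \<in> {0..1}" for x
    unfolding v_def using that by (intro arg_cong[where f = "(+) b"] integral_cong) (auto simp: u_def)
  have d: "(u has_vector_derivative v x) (at x within {0..1})" if x: "x \<in> {0..1}" for x
  proof -
    have "((\<lambda>x. a + x *\<^sub>R b + volterra Q z x) has_vector_derivative
        0 + 1 *\<^sub>R b + integral {0..x} (\<lambda>t. Q t *\<^sub>R z t)) (at x within {0..1})"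
      by (intro has_vector_derivative_add has_vector_derivative_const
          volterra_has_vector_derivative[OF Q z(1) x] has_vector_derivative_scaleR[THEN has_vector_derivative_eq_rhs]
          DERIV_ident) (auto intro!: derivative_eq_intros)
    then show ?thesis
      unfolding vz[OF x]
      by (rule has_vector_derivative_transform[OF x, rotated, THEN has_vector_derivative_eq_rhs])
        (use z(2) in \<open>auto simp: u_def\<close>)
  qed
  have "v x = v 0 + integral {0..x} (\<lambda>t. Q t *\<^sub>R u t)" for x
    by (simp add: v_def)
  from ivpI[OF d this] have "ivp Q u" "dv u 0 = v 0" by auto
  moreover have "u 0 = a" using z(2)[of 0] by (simp add: u_def volterra_def)
  moreover have "v 0 = b" by (simp add: v_def)
  ultimately have "dv u 0 = b" by simp
  with \<open>ivp Q u\<close> \<open>u 0 = a\<close> show ?thesis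
    by (rule that) (auto simp: u_def)
qed

lemma ivp_linear_combination:
  fixes u v :: "real \<Rightarrow> complex"
  assumes Q: "Q absolutely_integrable_on {0..1}" and u: "ivp Q u" and v: "ivp Q v"
  shows "ivp Q (\<lambda>x. a * u x + b * v x)"
    and "x \<in> {0..1} \<Longrightarrow> dv (\<lambda>x. a * u x + b * v x) x = a * dv u x + b * dv v x"
proof -
  let ?w = "\<lambda>x. a * u x + b * v x"
  have 1: "(?w has_vector_derivative (a * dv u x + b * dv v x)) (at x within {0..1})"
    if "x \<in> {0..1}" for x
    by (intro has_vector_derivative_add has_vector_derivative_mult_right ivpD(1)[OF u that] ivpD(1)[OF v that])
  have 2: "a * dv u x + b * dv v x = (a * dv u 0 + b * dv v 0) + integral {0..x} (\<lambda>t. Q t *\<^sub>R ?w t)"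
    if x: "x \<in> {0..1}" for x
  proof -
    have i: "(\<lambda>t. Q t *\<^sub>R z t) integrable_on {0..x}" if "ivp Q z" for z :: "real \<Rightarrow> complex"
      using absolutely_integrable_scaleR_continuous[OF Q ivp_continuous[OF that], of x] x
      by (auto intro: set_lebesgue_integral_eq_integral)
    have "integral {0..x} (\<lambda>t. Q t *\<^sub>R ?w t) =
        integral {0..x} (\<lambda>t. a * (Q t *\<^sub>R u t) + b * (Q t *\<^sub>R v t))"
      by (simp add: scaleR_add_right)
    also have "\<dots> = a * integral {0..x} (\<lambda>t. Q t *\<^sub>R u t) + b * integral {0..x} (\<lambda>t. Q t *\<^sub>R v t)"
      unfolding integral_add[OF integrable_on_mult_right[OF i[OF u]] integrable_on_mult_right[OF i[OF v]]]
      by (simp only: integral_mult_right)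
    finally show ?thesis
      unfolding ivpD(2)[OF u x] ivpD(2)[OF v x] by (simp add: algebra_simps)
  qed
  from ivpI[OF 1 2] show "ivp Q ?w" "x \<in> {0..1} \<Longrightarrow> dv ?w x = a * dv u x + b * dv v x" by auto
qed

lemma ivp_of_real:
  fixes y :: "real \<Rightarrow> real"
  assumes Q: "Q absolutely_integrable_on {0..1}" and y: "ivp Q y"
  shows "ivp Q (\<lambda>x. complex_of_real (y x))"
    and "x \<in> {0..1} \<Longrightarrow> dv (\<lambda>x. complex_of_real (y x)) x = of_real (dv y x)"
proof -
  have 1: "((\<lambda>x. complex_of_real (y x)) has_vector_derivative of_real (dv y x)) (at x within {0..1})"
    if "x \<in> {0..1}" for x
    using ivpD(1)[OF y that]
    by (intro has_vector_derivative_of_real)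
      (simp add: has_real_derivative_iff_has_vector_derivative)
  have 2: "complex_of_real (dv y x) = of_real (dv y 0) +
      integral {0..x} (\<lambda>t. Q t *\<^sub>R complex_of_real (y t))" if "x \<in> {0..1}" for x
  proof -
    have "(\<lambda>t. Q t * y t) integrable_on {0..x}"
      using absolutely_integrable_scaleR_continuous[OF Q ivp_continuous[OF y], of x] that
      by (auto intro: set_lebesgue_integral_eq_integral)
    from integral_linear[OF this bounded_linear_of_real]
    have "integral {0..x} (\<lambda>t. Q t *\<^sub>R complex_of_real (y t)) = of_real (integral {0..x} (\<lambda>t. Q t * y t))"
      by (simp add: scaleR_conv_of_real o_def)
    moreover have "dv y x = dv y 0 + integral {0..x} (\<lambda>t. Q t * y t)"
      using ivpD(2)[OF y that] unfolding real_scaleR_def .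
    ultimately show ?thesis by simp
  qed
  from ivpI[OF 1 2] show "ivp Q (\<lambda>x. complex_of_real (y x))"
    "x \<in> {0..1} \<Longrightarrow> dv (\<lambda>x. complex_of_real (y x)) x = of_real (dv y x)" by auto
qed

lemma ivp_unique:
  fixes u v :: "real \<Rightarrow> complex"
  assumes Q: "Q absolutely_integrable_on {0..1}" and u: "ivp Q u" and v: "ivp Q v"
    and "u 0 = v 0" "dv u 0 = dv v 0" "x \<in> {0..1}"
  shows "u x = v x"
  using ivp_zero[OF Q ivp_linear_combination(1)[OF Q u v, of 1 "-1"]]
    ivp_linear_combination(2)[OF Q u v, of 0 1 "-1"] assms by simp

section \<open>Square-integrable potentials, the function \<open>phi\<close>, and the passage
  between \<open>W22\<close> and \<open>ivp\<close>\<close>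

lemma L2_01_integrable:
  assumes "L2_01 q"
  shows "set_integrable lborel {0..1} q"
proof (rule set_integrable_bound)
  show "set_integrable lborel {0..1} (\<lambda>x. 1 + (q x)\<^sup>2)"
    using assms by (intro set_integral_add) (auto simp: L2_01_def intro!: borel_integrable_atLeastAtMost')
  show "set_borel_measurable lborel {0..1} q"
    using assms by (auto simp: L2_01_def set_borel_measurable_def)
  have "\<bar>q x\<bar> \<le> 1 + (q x)\<^sup>2" for x
    using abs_ge_zero[of "q x"] zero_le_power2[of "\<bar>q x\<bar> - 1"] by (simp add: power2_diff del: abs_ge_zero)
  then show "AE x in lborel. x \<in> {0..1} \<longrightarrow> norm (q x) \<le> norm (1 + (q x)\<^sup>2)"
    by auto
qed

lemma L2_01_absolutely_integrable:
  assumes "L2_01 q"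
  shows "(\<lambda>t. q t - lam) absolutely_integrable_on {0..1}"
proof -
  have "set_integrable lborel {0..1} (\<lambda>t. q t - lam)"
    using L2_01_integrable[OF assms]
    by (intro set_integral_diff) (auto intro!: borel_integrable_atLeastAtMost')
  moreover from this have "set_integrable lborel {0..1} (\<lambda>t. norm (q t - lam))"
    by (rule set_integrable_norm)
  ultimately show ?thesis
    unfolding absolutely_integrable_on_def by (auto intro: set_borel_integral_eq_integral)
qed

text \<open>Existence and uniqueness justify the definite description in \<open>phi\<close>.
  Vanishing outside \<open>{0..1}\<close> makes the solution unique as a total function.\<close>

lemma phi_ivp:
  assumes "L2_01 q"
  shows "ivp (\<lambda>t. q t - lam) (phi q lam)" "phi q lam 0 = 0" "dv (phi q lam) 0 = 1"
    "\<And>x. x \<notin> {0..1} \<Longrightarrow> phi q lam x = 0"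
proof -
  let ?Q = "\<lambda>t. q t - lam"
  let ?P = "\<lambda>y. sl_solution q lam y \<and> y 0 = 0 \<and> dv y 0 = 1 \<and> (\<forall>x. x \<notin> {0..1} \<longrightarrow> y x = 0)"
  note Q = L2_01_absolutely_integrable[OF assms, of lam]
  obtain y :: "real \<Rightarrow> real" where y: "ivp ?Q y" "y 0 = 0" "dv y 0 = 1" "\<And>x. x \<notin> {0..1} \<Longrightarrow> y x = 0"
    using ivp_exists[OF Q, of 0 1] by blast
  have "?P (phi q lam)"
    unfolding phi_def
  proof (rule theI[of ?P])
    show "?P y" using y by (auto simp: sl_solution_iff_ivp)
    fix z assume z: "?P z"
    then have iz: "ivp ?Q z" by (simp add: sl_solution_iff_ivp)
    show "z = y"
    proof
      fix x show "z x = y x"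
      proof (cases "x \<in> {0..1}")
        case True
        \<comment> \<open>\<open>ivp_unique\<close> is stated for complex functions, so the real
          solutions are compared after embedding.\<close>
        have "complex_of_real (z x) = complex_of_real (y x)"
          by (rule ivp_unique[OF Q ivp_of_real(1)[OF Q iz] ivp_of_real(1)[OF Q y(1)]])
            (use y z True ivp_of_real(2)[OF Q iz, of 0] ivp_of_real(2)[OF Q y(1), of 0] in auto)
        then show ?thesis by simp
      qed (use y z in auto)
    qed
  qed
  then show "ivp ?Q (phi q lam)" "phi q lam 0 = 0" "dv (phi q lam) 0 = 1"
    "\<And>x. x \<notin> {0..1} \<Longrightarrow> phi q lam x = 0" by (auto simp: sl_solution_iff_ivp)
qed

text \<open>The eigenvalue equation identifies \<open>g\<close> with \<open>(q - lam) u\<close> off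
  a null set, which the integrals do not see.\<close>

lemma W22_ivp:
  fixes u :: "real \<Rightarrow> complex"
  assumes W: "W22 u g"
    and ae: "AE x in lborel. x \<in> {0..1} \<longrightarrow> - g x + complex_of_real (q x) * u x = complex_of_real lam * u x"
  shows "ivp (\<lambda>t. q t - lam) u"
proof -
  define N where "N = {x \<in> {0..1}. g x \<noteq> (q x - lam) *\<^sub>R u x}"
  have "AE x in lborel. x \<notin> N"
    using ae by eventually_elim (auto simp: N_def scaleR_conv_of_real algebra_simps)
  \<comment> \<open>Negligibility refers to Lebesgue measure, while the equation holds almost
    everywhere for \<open>lborel\<close>.\<close>
  then have "AE x in lebesgue. x \<notin> N" by (rule AE_completion)
  then have "negligible N"
    by (simp add: negligible_iff_null_sets eventually_ae_filter) (meson completion.complete2)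
  then have eq: "integral {0..x} g = integral {0..x} (\<lambda>t. (q t - lam) *\<^sub>R u t)" if "x \<in> {0..1}" for x
    using that by (intro integral_spike) (auto simp: N_def)
  show ?thesis
    unfolding ivp_def
  proof
    fix x :: real assume x: "x \<in> {0..1}"
    from W x have "(u has_vector_derivative dv u x) (at x within {0..1})"
      and "dv u x = dv u 0 + integral {0..x} g"
      unfolding W22_def by blast+
    with eq[OF x] show "(u has_vector_derivative dv u x) (at x within {0..1}) \<and>
      dv u x = dv u 0 + integral {0..x} (\<lambda>t. (q t - lam) *\<^sub>R u t)" by simp
  qed
qed

text \<open>A solution is bounded on \<open>{0..1}\<close>, so \<open>(q - lam) u\<close> inherits
  square integrability from \<open>q\<close>.\<close>

lemma ivp_W22:
  fixes u :: "real \<Rightarrow> complex"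
  assumes q: "L2_01 q" and u: "ivp (\<lambda>t. q t - lam) u" and z: "\<And>x. x \<notin> {0..1} \<Longrightarrow> u x = 0"
  shows "W22 u (\<lambda>x. (q x - lam) *\<^sub>R u x)"
proof -
  have cont: "continuous_on {0..1} u" using u by (rule ivp_continuous)
  \<comment> \<open>Since \<open>u\<close> vanishes outside \<open>{0..1}\<close>, continuity there
    already gives measurability on the whole line.\<close>
  have "(\<lambda>x. indicator {0..1} x *\<^sub>R u x) \<in> borel_measurable borel"
    by (intro borel_measurable_continuous_on_indicator cont) auto
  moreover have "(\<lambda>x. indicator {0..1} x *\<^sub>R u x) = u"
    using z by (auto simp: indicator_def fun_eq_iff)
  ultimately have um: "u \<in> borel_measurable borel" by simp
  have qm: "q \<in> borel_measurable borel" using q by (simp add: L2_01_def)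
  have gm: "(\<lambda>x. (q x - lam) *\<^sub>R u x) \<in> borel_measurable borel"
    using um qm by measurable
  have "bounded (u ` {0..1})"
    by (intro compact_imp_bounded compact_continuous_image cont) auto
  then obtain C where C: "0 < C" "\<And>t. t \<in> {0..1} \<Longrightarrow> norm (u t) \<le> C"
    by (auto simp: bounded_pos)
  have i2: "set_integrable lborel {0..1} (\<lambda>x. 2 * C\<^sup>2 * ((q x)\<^sup>2 + lam\<^sup>2))"
    using q by (intro set_integrable_mult_right set_integral_add)
      (auto simp: L2_01_def intro!: borel_integrable_atLeastAtMost')
  have sq: "set_integrable lborel {0..1} (\<lambda>x. (cmod ((q x - lam) *\<^sub>R u x))\<^sup>2)"
  proof (rule set_integrable_bound[OF i2])
    show "set_borel_measurable lborel {0..1} (\<lambda>x. (cmod ((q x - lam) *\<^sub>R u x))\<^sup>2)"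
      using measurable_compose[OF gm borel_measurable_norm]
      unfolding set_borel_measurable_def by (intro borel_measurable_scaleR borel_measurable_power) auto
    have "norm ((cmod ((q x - lam) *\<^sub>R u x))\<^sup>2) \<le> norm (2 * C\<^sup>2 * ((q x)\<^sup>2 + lam\<^sup>2))" if "x \<in> {0..1}" for x
    proof -
      have "(cmod ((q x - lam) *\<^sub>R u x))\<^sup>2 = (q x - lam)\<^sup>2 * (cmod (u x))\<^sup>2"
        by (simp add: power_mult_distrib)
      also have "\<dots> \<le> (2 * ((q x)\<^sup>2 + lam\<^sup>2)) * C\<^sup>2"
        using C(2)[OF that] zero_le_power2[of "q x + lam"]
        by (intro mult_mono power_mono) (auto simp: power2_sum power2_diff)
      also have "\<dots> = 2 * C\<^sup>2 * ((q x)\<^sup>2 + lam\<^sup>2)" by (simp add: mult_ac)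
      finally show ?thesis by simp
    qed
    then show "AE x in lborel. x \<in> {0..1} \<longrightarrow>
        norm ((cmod ((q x - lam) *\<^sub>R u x))\<^sup>2) \<le> norm (2 * C\<^sup>2 * ((q x)\<^sup>2 + lam\<^sup>2))" by auto
  qed
  have i1: "set_integrable lborel {0..1} (\<lambda>x. 1 + (cmod ((q x - lam) *\<^sub>R u x))\<^sup>2)"
    by (intro set_integral_add sq) (auto intro!: borel_integrable_atLeastAtMost')
  have "set_integrable lborel {0..1} (\<lambda>x. (q x - lam) *\<^sub>R u x)"
  proof (rule set_integrable_bound[OF i1])
    show "set_borel_measurable lborel {0..1} (\<lambda>x. (q x - lam) *\<^sub>R u x)"
      using borel_measurable_scaleR[OF _ gm, of "indicator {0..1}"] unfolding set_borel_measurable_def by simp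
    have "t \<le> 1 + t\<^sup>2" if "0 \<le> t" for t :: real
      using that zero_le_power2[of "t - 1"] by (simp add: power2_diff)
    then show "AE x in lborel. x \<in> {0..1} \<longrightarrow>
        norm ((q x - lam) *\<^sub>R u x) \<le> norm (1 + (cmod ((q x - lam) *\<^sub>R u x))\<^sup>2)" by auto
  qed
  moreover have "(\<lambda>x. (q x - lam) *\<^sub>R u x) \<in> borel_measurable lborel" using gm by simp
  ultimately show ?thesis using ivpD[OF u] sq unfolding W22_def by blast
qed

section \<open>Summation and integral estimates\<close>

lemma UNIV_ej: "UNIV = {J0, J1, J2}"
  by (auto intro: ej.exhaust)

text \<open>The index set splits into three disjoint copies of \<open>'i\<close>, one per edge
  type.\<close>

lemma has_sum_ej:
  fixes F :: "'i \<Rightarrow> ej \<Rightarrow> real"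
  assumes "\<And>j. ((\<lambda>n. F n j) has_sum S j) UNIV"
  shows "((\<lambda>(n, j). F n j) has_sum (S J0 + S J1 + S J2)) UNIV"
proof -
  let ?R = "\<lambda>j. range (\<lambda>n::'i. (n, j::ej))"
  have R: "((\<lambda>(n, j). F n j) has_sum S j) (?R j)" for j
    using assms[of j] by (subst has_sum_reindex) (auto simp: inj_on_def o_def)
  have "((\<lambda>(n, j). F n j) has_sum (S J0 + S J1 + S J2)) (?R J0 \<union> ?R J1 \<union> ?R J2)"
    by (intro has_sum_Un_disjoint R) auto
  moreover have "?R J0 \<union> ?R J1 \<union> ?R J2 = UNIV"
    using UNIV_ej by auto (metis ej.exhaust rangeI)
  ultimately show ?thesis by simp
qed

lemma summable_on_ej_iff:
  fixes F :: "'i \<Rightarrow> ej \<Rightarrow> real"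
  shows "(\<lambda>(n, j). F n j) summable_on UNIV \<longleftrightarrow> (\<forall>j. (\<lambda>n. F n j) summable_on UNIV)"
proof
  assume "\<forall>j. (\<lambda>n. F n j) summable_on UNIV"
  then show "(\<lambda>(n, j). F n j) summable_on UNIV"
    by (intro has_sum_imp_summable[OF has_sum_ej[of F "\<lambda>j. \<Sum>\<^sub>\<infinity>n. F n j"]]) auto
next
  assume *: "(\<lambda>(n, j). F n j) summable_on UNIV"
  show "\<forall>j. (\<lambda>n. F n j) summable_on UNIV"
  proof
    fix j :: ej
    have "(\<lambda>(n, j). F n j) summable_on (range (\<lambda>n::'i. (n, j)))"
      by (rule summable_on_subset_banach[OF *]) simp
    then show "(\<lambda>n. F n j) summable_on UNIV"
      by (subst (asm) summable_on_reindex) (auto simp: inj_on_def o_def)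
  qed
qed

text \<open>The terms tend to 0 along the nonnegative integers. This rules out nonzero sequences
  that are constant over the cells.\<close>

lemma summable_on_int_lower_bound:
  fixes h :: "int \<Rightarrow> real"
  assumes h: "h summable_on UNIV" and d: "\<And>n. d \<le> h n"
  shows "d \<le> 0"
proof -
  have "h summable_on range int" by (rule summable_on_subset_banach[OF h]) simp
  then have "(\<lambda>n. h (int n)) summable_on UNIV"
    by (subst (asm) summable_on_reindex) (auto simp: o_def)
  then have "(\<lambda>n. h (int n)) \<longlonglongrightarrow> 0"
    by (intro summable_LIMSEQ_zero summable_on_imp_summable)
  then show ?thesis by (rule LIMSEQ_le_const) (use d in auto)
qed

text \<open>Symmetric windows eventually contain every finite set of integers, so the unordered sum
  is the limit of the window sums.\<close>

lemma infsum_int_tail_tendsto_zero: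
  fixes h :: "int \<Rightarrow> real"
  assumes h: "h summable_on UNIV"
  shows "(\<lambda>M. \<Sum>\<^sub>\<infinity>i. if i \<in> {- int M..int M} then 0 else h i) \<longlonglongrightarrow> 0"
proof -
  have "filterlim (\<lambda>M. {- int M..int M}) (finite_subsets_at_top UNIV) sequentially"
    unfolding filterlim_finite_subsets_at_top
  proof (intro allI impI)
    fix X :: "int set" assume X: "finite X \<and> X \<subseteq> UNIV"
    then obtain B where B: "\<And>x. x \<in> X \<Longrightarrow> \<bar>x\<bar> \<le> B"
      by (metis bdd_above_def bdd_above_finite finite_imageI imageI)
    have "X \<subseteq> {- int M..int M}" if "nat B \<le> M" for M
      using B that by (force simp: nat_le_iff)
    then show "\<forall>\<^sub>F M in sequentially. finite {- int M..int M} \<and> X \<subseteq> {- int M..int M} \<and> {- int M..int M} \<subseteq> UNIV"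
      by (auto simp: eventually_sequentially)
  qed
  then have "(\<lambda>M. sum h {- int M..int M}) \<longlonglongrightarrow> infsum h UNIV"
    using filterlim_compose has_sum_infsum[OF h] unfolding has_sum_def by blast
  then have "(\<lambda>M. infsum h UNIV - sum h {- int M..int M}) \<longlonglongrightarrow> infsum h UNIV - infsum h UNIV"
    by (intro tendsto_intros)
  moreover have "(\<Sum>\<^sub>\<infinity>i. if i \<in> {- int M..int M} then 0 else h i) = infsum h UNIV - sum h {- int M..int M}" for M
  proof -
    have "(\<Sum>\<^sub>\<infinity>i. if i \<in> {- int M..int M} then 0 else h i) = infsum h (UNIV - {- int M..int M})"
      by (intro infsum_cong_neutral) auto
    also have "\<dots> = infsum h UNIV - sum h {- int M..int M}"
      by (subst infsum_Diff) (auto intro: h)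
    finally show ?thesis .
  qed
  ultimately show ?thesis by simp
qed

section \<open>Positivity of quadratic integrals on the unit interval\<close>

lemma integral_square_pos:
  fixes g :: "real \<Rightarrow> real"
  assumes g: "continuous_on {0..1} g" and "x \<in> {0..1}" "g x \<noteq> 0"
  shows "0 < integral {0..1} (\<lambda>x. (g x)\<^sup>2)"
proof -
  have c: "continuous_on {0..1} (\<lambda>x. (g x)\<^sup>2)" by (intro continuous_intros g)
  have "0 \<le> integral {0..1} (\<lambda>x. (g x)\<^sup>2)"
    by (intro integral_nonneg integrable_continuous_real c) auto
  moreover have "integral {0..1} (\<lambda>x. (g x)\<^sup>2) \<noteq> 0"
    using integral_eq_0_iff[OF c] assms by auto
  ultimately show ?thesis by linarith
qed

text \<open>The bound \<open>d\<close> is the squared distance from \<open>\<theta>\<close> to the line spanned by \<open>\<phi>\<close>.\<close>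
lemma integral_square_dist_line_pos:
  fixes \<theta> \<phi> :: "real \<Rightarrow> real"
  assumes \<theta>: "continuous_on {0..1} \<theta>" and \<phi>: "continuous_on {0..1} \<phi>"
    and "\<theta> 0 \<noteq> 0" "\<phi> 0 = 0" and pos: "0 < integral {0..1} (\<lambda>x. (\<phi> x)\<^sup>2)"
  obtains d where "0 < d" "\<And>t. d \<le> integral {0..1} (\<lambda>x. (\<theta> x + t * \<phi> x)\<^sup>2)"
proof -
  define A B W where "A = integral {0..1} (\<lambda>x. (\<theta> x)\<^sup>2)"
    and "B = integral {0..1} (\<lambda>x. \<theta> x * \<phi> x)" and "W = integral {0..1} (\<lambda>x. (\<phi> x)\<^sup>2)"
  have eq: "integral {0..1} (\<lambda>x. (\<theta> x + t * \<phi> x)\<^sup>2) = A + (2 * t) * B + t\<^sup>2 * W" for t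
  proof -
    have "((\<lambda>x. (\<theta> x)\<^sup>2 + (2 * t) * (\<theta> x * \<phi> x) + t\<^sup>2 * (\<phi> x)\<^sup>2) has_integral
        (A + (2 * t) * B + t\<^sup>2 * W)) {0..1}"
      unfolding A_def B_def W_def
      by (intro has_integral_add has_integral_mult_right integrable_integral
          integrable_continuous_real continuous_intros \<theta> \<phi>)
    then show ?thesis
      by (intro integral_unique) (simp add: power2_sum power_mult_distrib mult_ac add_ac)
  qed
  have W: "0 < W" using pos by (simp add: W_def)
  \<comment> \<open>The quadratic polynomial in \<open>t\<close> is minimal at
    \<open>- B / W\<close>. The minimum is positive because the integrand is nonzero at 0, where
    \<phi> vanishes and \<theta> does not.\<close>
  let ?d = "integral {0..1} (\<lambda>x. (\<theta> x + (- B / W) * \<phi> x)\<^sup>2)"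
  show ?thesis
  proof (rule that[of ?d])
    show "0 < ?d"
      by (rule integral_square_pos[of _ 0]) (use assms W in \<open>auto intro!: continuous_intros\<close>)
    fix t
    have "A + (2 * t) * B + t\<^sup>2 * W - (A + (2 * (- B / W)) * B + (- B / W)\<^sup>2 * W) = (t * W + B)\<^sup>2 / W"
      using W by (simp add: field_simps power2_eq_square)
    moreover have "0 \<le> (t * W + B)\<^sup>2 / W" using W by simp
    ultimately show "?d \<le> integral {0..1} (\<lambda>x. (\<theta> x + t * \<phi> x)\<^sup>2)"
      unfolding eq by linarith
  qed
qed

lemma norm_sN [simp]: "cmod (sN m) = 1"
  by (simp add: sN_def)

text \<open>Take absolute values: \<open>sN m ^ k\<close> has modulus 1 and \<open>r\<close> is
  real. It serves both for \<open>r\<close> = \<theta>(1) and for \<open>cc q lam\<close>.\<close>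

lemma real_square_eq_1_if_unimodular_mult:
  fixes r :: real
  assumes "sN m ^ k * complex_of_real r ^ 2 = 1"
  shows "r\<^sup>2 = 1"
proof -
  have "cmod (sN m ^ k * complex_of_real r ^ 2) = 1" unfolding assms by simp
  then show ?thesis by (simp add: norm_mult norm_power)
qed

lemma int_constI:
  fixes h :: "int \<Rightarrow> 'a"
  assumes "\<And>n. h (n + 1) = h n"
  shows "h n = h n'"
  by (induction n rule: int_induct[of _ n']) (use assms in \<open>auto, metis diff_add_cancel\<close>)

section \<open>Eigenfunctions at Dirichlet eigenvalues\<close>

text \<open>The derivative conditions at the vertices for the components \<open>b n j\<close> times
  \<open>phi\<close>, whose derivatives are \<open>b n j\<close> at 0 and \<open>b n j * c\<close>
  at 1. The continuity conditions are automatic, as \<open>phi\<close> vanishes at both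
  ends.\<close>

definition kirchhoff :: "complex \<Rightarrow> complex \<Rightarrow> (int \<Rightarrow> ej \<Rightarrow> complex) \<Rightarrow> bool" where
  "kirchhoff w c b \<longleftrightarrow> (\<forall>n. - (b n J0 * c) + b n J1 - w * (b n J2 * c) = 0 \<and>
     b (n + 1) J0 - b n J1 * c + b n J2 = 0)"

locale dirichlet =
  fixes q :: "real \<Rightarrow> real" and m k :: nat and lam :: real
  assumes hq: "L2_01 q" and hlam: "lam \<in> sigma_D q"
begin

abbreviation "Q \<equiv> \<lambda>t. q t - lam"
abbreviation "ph \<equiv> \<lambda>x. complex_of_real (phi q lam x)"
abbreviation "c \<equiv> complex_of_real (cc q lam)"
abbreviation "w \<equiv> sN m ^ k"
abbreviation "\<eta> \<equiv> eta q m k lam"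

definition W :: real where "W = (LINT x:{0..1}|lborel. (phi q lam x)\<^sup>2)"

lemmas Q = L2_01_absolutely_integrable[where lam = lam, OF hq]
lemmas phi = phi_ivp[where lam = lam, OF hq]
lemmas phi_cont = ivp_continuous[OF phi(1)]

lemma phi_1: "phi q lam 1 = 0"
  using hlam by (simp add: sigma_D_def)

lemma W_integral: "W = integral {0..1} (\<lambda>x. (phi q lam x)\<^sup>2)"
  unfolding W_def
  by (intro set_borel_integral_eq_integral borel_integrable_atLeastAtMost' continuous_intros phi_cont)

text \<open>If \<open>phi\<close> vanished on all of \<open>{0..1}\<close>, its derivative at 0
  would be 0 instead of 1.\<close>

lemma W_pos: "0 < W"
proof -
  have "\<exists>x\<in>{0..1}. phi q lam x \<noteq> 0"
  proof (rule ccontr)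
    assume *: "\<not> ?thesis"
    have "(phi q lam has_vector_derivative 0) (at 0 within {0..1})"
      by (rule has_vector_derivative_transform[of 0 _ _ "\<lambda>_. 0"]) (use * in auto)
    from dv_eqI[OF this] phi(3) show False by simp
  qed
  then show ?thesis
    unfolding W_integral using integral_square_pos[OF phi_cont] by blast
qed

definition edge :: "(int \<Rightarrow> ej \<Rightarrow> complex) \<Rightarrow> int \<Rightarrow> ej \<Rightarrow> real \<Rightarrow> complex" where
  "edge b n j x = b n j * ph x"

lemma edge_ivp: "ivp Q (edge b n j)"
  and dv_edge: "x \<in> {0..1} \<Longrightarrow> dv (edge b n j) x = b n j * of_real (dv (phi q lam) x)"
  using ivp_linear_combination[OF Q ivp_of_real(1)[OF Q phi(1)] ivp_of_real(1)[OF Q phi(1)],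
      where a = "b n j" and b = 0]
    ivp_of_real(2)[OF Q phi(1)]
  by (simp_all add: edge_def[abs_def])

lemma LINT_edge: "(LINT x:{0..1}|lborel. (cmod (b * ph x))\<^sup>2) = (cmod b)\<^sup>2 * W"
  by (simp add: W_def norm_mult power_mult_distrib)

lemma edge_in_eigsp:
  assumes b: "(\<lambda>(n, j). (cmod (b n j))\<^sup>2) summable_on UNIV" and kir: "kirchhoff w c b"
  shows "edge b \<in> eigsp q m k lam"
proof -
  define g where "g n j x = Q x *\<^sub>R edge b n j x" for n j x
  have zero: "edge b n j x = 0" if "x \<notin> {0..1}" for n j x
    using phi(4)[OF that] by (simp add: edge_def)
  have W22: "W22 (edge b n j) (g n j)" for n j
    unfolding g_def[abs_def] by (intro ivp_W22 hq edge_ivp zero)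
  have scale: "(\<lambda>(n, j). (cmod (b n j))\<^sup>2 * t) summable_on UNIV" for t
    using summable_on_cmult_left[OF b, of t] by (simp add: case_prod_unfold)
  have L2: "L2_graph (edge b)"
    unfolding L2_graph_def
  proof (intro conjI allI)
    show "set_integrable lborel {0..1} (\<lambda>x. (cmod (edge b n j x))\<^sup>2)" for n j
      by (intro borel_integrable_atLeastAtMost' continuous_intros ivp_continuous[OF edge_ivp])
    show "(\<lambda>(n, j). LINT x:{0..1}|lborel. (cmod (edge b n j x))\<^sup>2) summable_on UNIV"
      using scale[of W] by (simp add: edge_def LINT_edge)
  qed
  have L2': "L2_graph (\<lambda>n j x. indicator {0..1} x * g n j x)"
    unfolding L2_graph_def
  proof (intro conjI allI)
    fix n j
    have "set_integrable lborel {0..1} (\<lambda>x. (cmod (g n j x))\<^sup>2)"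
      using W22[of n j] by (simp add: W22_def)
    then show "set_integrable lborel {0..1} (\<lambda>x. (cmod (indicator {0..1} x * g n j x))\<^sup>2)"
      by (rule set_integrable_cong[THEN iffD1, rotated -1]) auto
  next
    \<comment> \<open>\<open>G\<close> plays for the second derivatives the part that
      \<open>W\<close> plays for the functions.\<close>
    define G where "G = (LINT x:{0..1}|lborel. (cmod (Q x *\<^sub>R ph x))\<^sup>2)"
    have "(LINT x:{0..1}|lborel. (cmod (indicator {0..1} x * g n j x))\<^sup>2) = (cmod (b n j))\<^sup>2 * G" for n j
    proof -
      have "(LINT x:{0..1}|lborel. (cmod (indicator {0..1} x * g n j x))\<^sup>2) =
          (LINT x:{0..1}|lborel. (cmod (b n j))\<^sup>2 * (cmod (Q x *\<^sub>R ph x))\<^sup>2)"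
        by (intro set_lebesgue_integral_cong)
          (auto simp: g_def edge_def norm_mult power_mult_distrib)
      then show ?thesis by (simp add: G_def)
    qed
    then show "(\<lambda>(n, j). LINT x:{0..1}|lborel. (cmod (indicator {0..1} x * g n j x))\<^sup>2) summable_on UNIV"
      using scale[of G] by simp
  qed
  have "edge b n j 0 = 0" "edge b n j 1 = 0" "dv (edge b n j) 0 = b n j" "dv (edge b n j) 1 = b n j * c" for n j
    by (simp_all add: dv_edge phi_1 phi edge_def cc_def)
  then have "vertex_conds m k (edge b)"
    using kir by (simp add: vertex_conds_def kirchhoff_def)
  with W22 L2 L2' zero have "edge b \<in> dom_H m k"
    unfolding dom_H_def by blast
  moreover have "\<forall>n j. AE x in lborel. x \<in> {0..1} \<longrightarrow>
      - g n j x + complex_of_real (q x) * edge b n j x = complex_of_real lam * edge b n j x"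
    by (simp add: g_def scaleR_conv_of_real algebra_simps)
  ultimately show ?thesis
    unfolding eigsp_def using W22 by blast
qed

section \<open>Every eigenfunction is a multiple of \<open>phi\<close> on each edge\<close>

lemma eigsp_ivp:
  assumes "f \<in> eigsp q m k lam"
  shows "ivp Q (f n j)"
  using assms W22_ivp unfolding eigsp_def by blast

lemma eigsp_vanishes_at_vertices:
  assumes f: "f \<in> eigsp q m k lam"
  shows "f n j 0 = 0" and "f n j 1 = 0"
proof -
  obtain \<theta> :: "real \<Rightarrow> real" where \<theta>: "ivp Q \<theta>" "\<theta> 0 = 1" "dv \<theta> 0 = 0"
    using ivp_exists[OF Q, of 1 0] by blast
  define r where "r = \<theta> 1"
  have rep: "f n j x = f n j 0 * of_real (\<theta> x) + dv (f n j) 0 * ph x" if "x \<in> {0..1}" for n j x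
  proof (rule ivp_unique[OF Q eigsp_ivp[OF f] ivp_linear_combination(1)[OF Q] _ _ that])
    show \<theta>': "ivp Q (\<lambda>x. complex_of_real (\<theta> x))" and ph': "ivp Q ph"
      using ivp_of_real(1)[OF Q] \<theta> phi by auto
    show "dv (f n j) 0 = dv (\<lambda>x. f n j 0 * of_real (\<theta> x) + dv (f n j) 0 * ph x) 0"
      using ivp_linear_combination(2)[OF Q \<theta>' ph'] ivp_of_real(2)[OF Q \<theta>(1)] ivp_of_real(2)[OF Q phi(1)] \<theta> phi
      by simp
  qed (use \<theta> phi in auto)
  have end1: "f n j 1 = f n j 0 * of_real r" for n j
    using rep[of 1 n j] by (simp add: r_def phi_1)
  have V: "vertex_conds m k f" and L2: "L2_graph f"
    using f by (auto simp: eigsp_def dom_H_def)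
  define v where "v n = f n J1 0" for n
  have v: "f n J0 1 = v n" "v n = w * f n J2 1" "f (n + 1) J0 0 = f n J1 1" "f n J2 0 = f n J1 1" for n
    using V by (auto simp: vertex_conds_def v_def)
  \<comment> \<open>Go along the edge \<open>J1\<close> of cell \<open>n\<close> and then
    \<open>J0\<close> of cell \<open>n + 1\<close>; each contributes a factor
    \<open>r\<close>.\<close>
  have vs: "v (n + 1) = v n * (of_real r)\<^sup>2" for n
    using v(1)[of "n + 1"] v(3)[of n] end1[of "n + 1" J0] end1[of n J1]
    by (simp add: v_def power2_eq_square mult.assoc)
  \<comment> \<open>Go around the cycle formed by \<open>J1\<close> and \<open>J2\<close> of the
    same cell; the condition at the end of \<open>J2\<close> contributes \<open>w\<close>.\<close>
  have vw: "v n = v n * (w * (of_real r)\<^sup>2)" for n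
    using v(2)[of n] v(4)[of n] end1[of n J2] end1[of n J1] by (simp add: v_def power2_eq_square mult_ac)
  have v0: "v n = 0" for n
  proof (rule ccontr)
    assume n: "v n \<noteq> 0"
    then have "w * (of_real r)\<^sup>2 = 1" using vw[of n] by simp
    then have "r\<^sup>2 = 1" by (rule real_square_eq_1_if_unimodular_mult)
    then have "(complex_of_real r)\<^sup>2 = 1" by (metis of_real_1 of_real_power)
    then have "v (i + 1) = v i" for i using vs by simp
    then have const: "v i = v n" for i by (rule int_constI)
    obtain d where d: "0 < d" "\<And>t. d \<le> integral {0..1} (\<lambda>x. (\<theta> x + t * phi q lam x)\<^sup>2)"
      using integral_square_dist_line_pos[OF ivp_continuous[OF \<theta>(1)] phi_cont] \<theta>(2) phi(2) W_pos
      unfolding W_integral by auto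
    have "(cmod (v n))\<^sup>2 * d \<le> (LINT x:{0..1}|lborel. (cmod (f i J1 x))\<^sup>2)" for i
    proof -
      define t where "t = dv (f i J1) 0 / v n"
      \<comment> \<open>Since \<theta> and \<open>phi\<close> are real, dropping the imaginary part
        of \<open>t\<close> only decreases the modulus. This makes the real bound \<open>d\<close>,
        which is independent of \<open>i\<close>, applicable.\<close>
      have le: "(cmod (v n))\<^sup>2 * (\<theta> x + Re t * phi q lam x)\<^sup>2 \<le> (cmod (f i J1 x))\<^sup>2" if "x \<in> {0..1}" for x
      proof -
        have "f i J1 x = v n * (of_real (\<theta> x) + t * ph x)"
          using rep[OF that, of i J1] const[of i] n by (simp add: t_def v_def field_simps)
        moreover have "(\<theta> x + Re t * phi q lam x)\<^sup>2 \<le> (cmod (of_real (\<theta> x) + t * ph x))\<^sup>2"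
          unfolding cmod_power2 by simp
        ultimately show ?thesis by (simp add: norm_mult power_mult_distrib mult_left_mono)
      qed
      have "(cmod (v n))\<^sup>2 * d \<le> (cmod (v n))\<^sup>2 * integral {0..1} (\<lambda>x. (\<theta> x + Re t * phi q lam x)\<^sup>2)"
        by (intro mult_left_mono d) auto
      also have "\<dots> = integral {0..1} (\<lambda>x. (cmod (v n))\<^sup>2 * (\<theta> x + Re t * phi q lam x)\<^sup>2)"
        by simp
      also have "\<dots> \<le> integral {0..1} (\<lambda>x. (cmod (f i J1 x))\<^sup>2)"
        by (intro integral_le integrable_continuous_real continuous_intros le
            ivp_continuous[OF eigsp_ivp[OF f]] ivp_continuous[OF \<theta>(1)] phi_cont)
      also have "\<dots> = (LINT x:{0..1}|lborel. (cmod (f i J1 x))\<^sup>2)"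
        using L2 by (intro set_borel_integral_eq_integral(2)[symmetric]) (simp add: L2_graph_def)
      finally show ?thesis .
    qed
    moreover have "(\<lambda>i. LINT x:{0..1}|lborel. (cmod (f i J1 x))\<^sup>2) summable_on UNIV"
      using L2 unfolding L2_graph_def summable_on_ej_iff by blast
    ultimately have "(cmod (v n))\<^sup>2 * d \<le> 0"
      by (intro summable_on_int_lower_bound) auto
    moreover have "0 < (cmod (v n))\<^sup>2 * d" using n d(1) by simp
    ultimately show False by linarith
  qed
  have J1: "f n J1 0 = 0" for n using v0[of n] by (simp add: v_def)
  have J1': "f n J1 1 = 0" for n using J1 end1 by simp
  have "f n J0 0 = 0" for n using v(3)[of "n - 1"] J1' by simp
  moreover have "f n J2 0 = 0" for n using v(4) J1' by simp
  ultimately show "f n j 0 = 0" using J1 by (cases j) auto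
  then show "f n j 1 = 0" using end1 by simp
qed

text \<open>Each component vanishes at 0, so by uniqueness it is \<open>phi\<close> times its
  derivative at 0.\<close>

lemma eigsp_eq_edge:
  assumes f: "f \<in> eigsp q m k lam"
  obtains b where "f = edge b" "kirchhoff w c b" "(\<lambda>(n, j). (cmod (b n j))\<^sup>2) summable_on UNIV"
proof -
  define b where "b n j = dv (f n j) 0" for n j
  have fz: "f n j x = 0" if "x \<notin> {0..1}" for n j x
    using f that by (simp add: eigsp_def dom_H_def)
  have fe: "f = edge b"
  proof (intro ext)
    fix n j x
    show "f n j x = edge b n j x"
    proof (cases "x \<in> {0..1}")
      case True
      show ?thesis
        by (rule ivp_unique[OF Q eigsp_ivp[OF f] edge_ivp _ _ True])
          (use eigsp_vanishes_at_vertices[OF f] phi in \<open>auto simp: dv_edge b_def edge_def\<close>)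
    qed (use fz phi(4) in \<open>auto simp: edge_def\<close>)
  qed
  have V: "vertex_conds m k f" and L2: "L2_graph f"
    using f by (auto simp: eigsp_def dom_H_def)
  have "kirchhoff w c b"
    using V unfolding fe vertex_conds_def kirchhoff_def by (simp add: dv_edge phi cc_def)
  moreover have "(\<lambda>(n, j). (cmod (b n j))\<^sup>2 * W) summable_on UNIV"
    using L2 unfolding fe L2_graph_def by (simp add: edge_def LINT_edge)
  \<comment> \<open>Positivity of \<open>W\<close> turns summability of the edge norms into
    summability of the coefficients.\<close>
  from summable_on_cmult_left[OF this, of "1 / W"]
  have "(\<lambda>(n, j). (cmod (b n j))\<^sup>2) summable_on UNIV"
    using W_pos by (simp add: case_prod_unfold)
  ultimately show ?thesis using that fe by blast
qed

text \<open>The function \<open>\<psi>\<close> with index \<open>n\<close> has coefficients \<open>B0\<close> on cell \<open>n\<close> and \<open>B1\<close> on cell \<open>n - 1\<close>, so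
  \<open>syn a\<close> collects the coefficients of the expansion with coefficient sequence \<open>a\<close>.\<close>
definition B0 :: "ej \<Rightarrow> complex" where
  "B0 j = (if \<eta> \<noteq> 0 then case j of J0 \<Rightarrow> \<eta> | J1 \<Rightarrow> c | J2 \<Rightarrow> c\<^sup>2
           else case j of J0 \<Rightarrow> 0 | J1 \<Rightarrow> 1 | J2 \<Rightarrow> c)"

definition B1 :: "ej \<Rightarrow> complex" where
  "B1 j = (if \<eta> \<noteq> 0 then case j of J0 \<Rightarrow> 0 | J1 \<Rightarrow> - w * c | J2 \<Rightarrow> - 1 else 0)"

definition syn :: "(int \<Rightarrow> complex) \<Rightarrow> int \<Rightarrow> ej \<Rightarrow> complex" where
  "syn a n j = a n * B0 j + a (n + 1) * B1 j"

lemma psi_eq_edge: "psi q m k lam n = edge (syn (\<lambda>i. if i = n then 1 else 0))"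
proof (intro ext)
  fix p j x
  consider "p = n" | "p + 1 = n" | "p \<noteq> n" "p + 1 \<noteq> n" by blast
  then show "psi q m k lam n p j x = edge (syn (\<lambda>i. if i = n then 1 else 0)) p j x"
    by cases (auto simp: psi_def psi0_def edge_def syn_def B0_def B1_def Let_def split: ej.split)
qed

lemma kirchhoff_syn: "kirchhoff w c (syn a)"
  unfolding kirchhoff_def syn_def B0_def B1_def
  by (auto simp: eta_def algebra_simps power2_eq_square)

lemma fhat_edge: "fhat q m k lam (edge b) n = (if \<eta> \<noteq> 0 then b n J0 / \<eta> else b n J1)"
  by (simp add: fhat_def dv_edge phi)

text \<open>\<open>fhat\<close> reads the edge type on which \<open>B1\<close> vanishes and
  \<open>B0\<close> is known: \<open>J0\<close> with value \<eta> if \<eta> is nonzero, otherwise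
  \<open>J1\<close> with value 1.\<close>

lemma fhat_edge_syn: "fhat q m k lam (edge (syn a)) = a"
  by (rule ext) (simp add: fhat_edge syn_def B0_def B1_def)

text \<open>If \<eta> is nonzero, the recurrences express the coefficients on \<open>J1\<close> and
  \<open>J2\<close> through those on \<open>J0\<close> in cells \<open>n\<close> and
  \<open>n + 1\<close>. If \<eta> is 0, square summability is what removes the extra solutions with
  \<open>J0\<close> coefficients constant in \<open>n\<close>.\<close>

lemma syn_fhat_edge:
  assumes kir: "kirchhoff w c b" and b: "(\<lambda>(n, j). (cmod (b n j))\<^sup>2) summable_on UNIV"
  shows "syn (fhat q m k lam (edge b)) = b"
proof (intro ext)
  fix n j
  have k1: "b n J1 = b n J0 * c + w * (b n J2 * c)" for n
    using kir by (simp add: kirchhoff_def algebra_simps)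
  have k2: "b (n + 1) J0 = b n J1 * c - b n J2" for n
  proof -
    have "b (n + 1) J0 - (b n J1 * c - b n J2) = 0"
      using kir by (simp add: kirchhoff_def diff_diff_eq2 diff_add_eq)
    then show ?thesis by simp
  qed
  show "syn (fhat q m k lam (edge b)) n j = b n j"
  proof (cases "\<eta> = 0")
    case True
    then have wc: "w * c\<^sup>2 = 1" by (simp add: eta_def)
    then have "(cc q lam)\<^sup>2 = 1" by (rule real_square_eq_1_if_unimodular_mult)
    then have c2: "c\<^sup>2 = 1" by (metis of_real_1 of_real_power)
    with wc have w: "w = 1" by simp
    have "b (n + 1) J0 = b n J0" for n
      using c2 unfolding k2 k1 w by (simp add: algebra_simps power2_eq_square)
    then have const: "b i J0 = b n J0" for i by (rule int_constI)
    have "(\<lambda>n. (cmod (b n J0))\<^sup>2) summable_on UNIV"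
      using b unfolding summable_on_ej_iff by blast
    then have "(cmod (b n J0))\<^sup>2 \<le> 0"
      by (rule summable_on_int_lower_bound) (metis const order_refl)
    then have z: "b n J0 = 0" by simp
    then have "b n J2 = b n J1 * c"
      using k1[of n] c2 by (simp add: w algebra_simps power2_eq_square)
    with z True show ?thesis
      by (cases j) (auto simp: syn_def fhat_edge B0_def B1_def)
  next
    case False
    have "\<eta> * b n J1 = b n J0 * c - b (n + 1) J0 * (w * c)"
      "\<eta> * b n J2 = b n J0 * c\<^sup>2 - b (n + 1) J0"
      unfolding k2 eta_def by (simp_all add: k1 algebra_simps power2_eq_square)
    with False show ?thesis
      by (cases j) (auto simp: syn_def fhat_edge B0_def B1_def field_simps)
  qed
qed

section \<open>Boundedness of the synthesis map and convergence of the expansion\<close>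

definition D :: "ej \<Rightarrow> real" where "D j = 2 * ((cmod (B0 j))\<^sup>2 + (cmod (B1 j))\<^sup>2)"

lemma norm_syn_le: "(cmod (syn a n j))\<^sup>2 \<le> D j * ((cmod (a n))\<^sup>2 + (cmod (a (n + 1)))\<^sup>2)"
proof -
  let ?x = "cmod (a n) * cmod (B0 j)" and ?y = "cmod (a (n + 1)) * cmod (B1 j)"
  have "(cmod (syn a n j))\<^sup>2 \<le> (?x + ?y)\<^sup>2"
    unfolding syn_def norm_mult[symmetric] by (intro power_mono norm_triangle_ineq) auto
  also have "\<dots> \<le> 2 * ?x\<^sup>2 + 2 * ?y\<^sup>2"
    using zero_le_power2[of "?x - ?y"] by (simp add: power2_sum power2_diff)
  also have "\<dots> \<le> D j * ((cmod (a n))\<^sup>2 + (cmod (a (n + 1)))\<^sup>2)"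
    by (simp add: D_def power_mult_distrib algebra_simps)
  finally show ?thesis .
qed

lemma
  assumes a: "a \<in> l2Z"
  shows syn_summable: "(\<lambda>(n, j). (cmod (syn a n j))\<^sup>2) summable_on UNIV"
    and infsum_syn_le: "(\<Sum>\<^sub>\<infinity>(n, j). (cmod (syn a n j))\<^sup>2) \<le>
      2 * (D J0 + D J1 + D J2) * (\<Sum>\<^sub>\<infinity>n. (cmod (a n))\<^sup>2)"
proof -
  define S where "S = (\<Sum>\<^sub>\<infinity>n. (cmod (a n))\<^sup>2)"
  have 1: "((\<lambda>n. (cmod (a n))\<^sup>2) has_sum S) UNIV"
    using a by (simp add: l2Z_def S_def)
  \<comment> \<open>The shifted sequence has the same sum \<open>S\<close>, which accounts for the
    factor 2 in the bound.\<close>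
  moreover have "bij (\<lambda>n::int. n + 1)" by (rule bij_plus_right)
  ultimately have 2: "((\<lambda>n. (cmod (a (n + 1)))\<^sup>2) has_sum S) UNIV"
    using has_sum_reindex_bij_betw[of "\<lambda>n. n + 1" UNIV UNIV "\<lambda>n. (cmod (a n))\<^sup>2" S] by simp
  have "((\<lambda>n. D j * ((cmod (a n))\<^sup>2 + (cmod (a (n + 1)))\<^sup>2)) has_sum (D j * (S + S))) UNIV" for j
    by (intro has_sum_cmult_right has_sum_add 1 2)
  from has_sum_ej[of "\<lambda>n j. D j * ((cmod (a n))\<^sup>2 + (cmod (a (n + 1)))\<^sup>2)", OF this]
  have h: "((\<lambda>(n, j). D j * ((cmod (a n))\<^sup>2 + (cmod (a (n + 1)))\<^sup>2)) has_sum
      2 * (D J0 + D J1 + D J2) * S) UNIV"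
    by (simp add: algebra_simps)
  show s: "(\<lambda>(n, j). (cmod (syn a n j))\<^sup>2) summable_on UNIV"
    by (rule summable_on_comparison_test[OF has_sum_imp_summable[OF h]]) (auto intro: norm_syn_le)
  show "(\<Sum>\<^sub>\<infinity>(n, j). (cmod (syn a n j))\<^sup>2) \<le> 2 * (D J0 + D J1 + D J2) * (\<Sum>\<^sub>\<infinity>n. (cmod (a n))\<^sup>2)"
    unfolding S_def[symmetric]
    by (rule has_sum_mono[OF has_sum_infsum[OF s] h]) (auto intro: norm_syn_le)
qed

lemma edge_syn_in_eigsp: "a \<in> l2Z \<Longrightarrow> edge (syn a) \<in> eigsp q m k lam"
  by (intro edge_in_eigsp syn_summable kirchhoff_syn)

lemma edge_syn_fhat: "f \<in> eigsp q m k lam \<Longrightarrow> edge (syn (fhat q m k lam f)) = f"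
  by (metis eigsp_eq_edge syn_fhat_edge)

lemma fhat_in_l2Z:
  assumes "f \<in> eigsp q m k lam"
  shows "fhat q m k lam f \<in> l2Z"
proof -
  obtain b where f: "f = edge b" and b: "(\<lambda>(n, j). (cmod (b n j))\<^sup>2) summable_on UNIV"
    using eigsp_eq_edge[OF assms] by metis
  then have s: "(\<lambda>n. (cmod (b n j))\<^sup>2) summable_on UNIV" for j
    unfolding summable_on_ej_iff by blast
  \<comment> \<open>For \<eta> = 0 the factor is 0 by the convention for division, so the claim
    holds before the case split.\<close>
  then have "(\<lambda>n. (cmod (b n J0))\<^sup>2 * (1 / (cmod \<eta>)\<^sup>2)) summable_on UNIV"
    by (intro summable_on_cmult_left)
  with s show ?thesis
    by (cases "\<eta> = 0") (simp_all add: l2Z_def f fhat_edge norm_divide power_divide)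
qed

lemma psi_eigsp: "psi q m k lam n \<in> eigsp q m k lam"
  unfolding psi_eq_edge l2Z_def
  by (intro edge_syn_in_eigsp) (auto simp: l2Z_def intro!: finite_nonzero_values_imp_summable_on)

text \<open>On cell \<open>p\<close> only the terms with \<open>n = p\<close> and
  \<open>n = p + 1\<close> can be nonzero.\<close>

lemma psi_expansion_has_sum:
  "((\<lambda>n. a n * psi q m k lam n p j x) has_sum edge (syn a) p j x) UNIV"
  by (rule has_sum_finite_neutralI[of "{p, p + 1}"])
    (auto simp: psi_eq_edge edge_def syn_def algebra_simps)

lemma psi_expansion_remainder:
  assumes "finite S"
  shows "edge (syn a) p j x - (\<Sum>n\<in>S. a n * psi q m k lam n p j x) =
    edge (syn (\<lambda>i. if i \<in> S then 0 else a i)) p j x"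
proof -
  have "(\<Sum>n\<in>S. a n * psi q m k lam n p j x) =
      (\<Sum>n\<in>S. (if n = p then a p * B0 j * ph x else 0) + (if n = p + 1 then a (p + 1) * B1 j * ph x else 0))"
    by (intro sum.cong) (auto simp: psi_eq_edge edge_def syn_def)
  then show ?thesis
    using assms by (auto simp: sum.distrib sum.delta edge_def syn_def algebra_simps)
qed

text \<open>The remainder is the synthesis of the truncated sequence, so its squared norm is at most
  a constant times the tail of the sum of squares of \<open>a\<close>.\<close>

lemma psi_expansion_tendsto:
  assumes a: "a \<in> l2Z"
  shows "(\<lambda>M::nat. \<Sum>\<^sub>\<infinity>(p, j). LINT x:{0..1}|lborel.
      (cmod (edge (syn a) p j x - (\<Sum>n\<in>{- int M..int M}. a n * psi q m k lam n p j x)))\<^sup>2) \<longlonglongrightarrow> 0"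
    (is "?L \<longlonglongrightarrow> 0")
proof -
  define t where "t M = (\<lambda>i. if i \<in> {- int M..int M} then 0 else a i)" for M
  have h: "(\<lambda>n. (cmod (a n))\<^sup>2) summable_on UNIV" using a by (simp add: l2Z_def)
  have t2: "(\<lambda>i. (cmod (t M i))\<^sup>2) = (\<lambda>i. if i \<in> {- int M..int M} then 0 else (cmod (a i))\<^sup>2)" for M
    by (auto simp: t_def)
  have t: "t M \<in> l2Z" for M
    unfolding l2Z_def using summable_on_comparison_test[OF h] by (auto simp: t_def)
  have L: "?L M = (\<Sum>\<^sub>\<infinity>(n, j). (cmod (syn (t M) n j))\<^sup>2) * W" for M
  proof -
    have "?L M = (\<Sum>\<^sub>\<infinity>(n, j). (cmod (syn (t M) n j))\<^sup>2 * W)"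
      unfolding psi_expansion_remainder[OF finite_atLeastAtMost_int] t_def[symmetric]
      unfolding edge_def LINT_edge ..
    also have "\<dots> = (\<Sum>\<^sub>\<infinity>(n, j). (cmod (syn (t M) n j))\<^sup>2) * W"
      using infsum_cmult_left'[of "\<lambda>(n, j). (cmod (syn (t M) n j))\<^sup>2" W UNIV] by (simp add: case_prod_unfold)
    finally show ?thesis .
  qed
  have "(\<lambda>M. 2 * (D J0 + D J1 + D J2) * (\<Sum>\<^sub>\<infinity>i. (cmod (t M i))\<^sup>2) * W) \<longlonglongrightarrow>
      2 * (D J0 + D J1 + D J2) * 0 * W"
    unfolding t2 by (intro tendsto_intros infsum_int_tail_tendsto_zero h)
  then have lim: "(\<lambda>M. 2 * (D J0 + D J1 + D J2) * (\<Sum>\<^sub>\<infinity>i. (cmod (t M i))\<^sup>2) * W) \<longlonglongrightarrow> 0"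
    by simp
  show ?thesis
  proof (rule tendsto_sandwich[OF _ _ tendsto_const lim])
    show "\<forall>\<^sub>F M in sequentially. 0 \<le> ?L M"
      unfolding L using W_pos by (intro always_eventually allI mult_nonneg_nonneg infsum_nonneg) auto
    show "\<forall>\<^sub>F M in sequentially. ?L M \<le> 2 * (D J0 + D J1 + D J2) * (\<Sum>\<^sub>\<infinity>i. (cmod (t M i))\<^sup>2) * W"
      unfolding L using W_pos by (intro always_eventually allI mult_right_mono infsum_syn_le t) auto
  qed
qed

text \<open>\<open>fhat\<close> is built from \<open>dv\<close>, which is only well behaved on
  differentiable functions; writing both eigenfunctions as \<open>edge\<close> reduces the claim to
  coefficients.\<close>

lemma fhat_linear:
  assumes "f \<in> eigsp q m k lam" "g \<in> eigsp q m k lam"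
  shows "fhat q m k lam (\<lambda>n j x. a * f n j x + b * g n j x) =
    (\<lambda>n. a * fhat q m k lam f n + b * fhat q m k lam g n)"
proof -
  obtain u v where f: "f = edge u" and g: "g = edge v"
    using eigsp_eq_edge[OF assms(1)] eigsp_eq_edge[OF assms(2)] by metis
  have "(\<lambda>n j x. a * f n j x + b * g n j x) = edge (\<lambda>n j. a * u n j + b * v n j)"
    by (intro ext) (simp add: f g edge_def algebra_simps)
  then show ?thesis
    by (auto simp: f g fhat_edge add_divide_distrib)
qed

lemma bij_betw_fhat: "bij_betw (fhat q m k lam) (eigsp q m k lam) l2Z"
  by (rule bij_betwI[of _ _ _ "\<lambda>a. edge (syn a)"])
    (auto simp: fhat_in_l2Z edge_syn_in_eigsp edge_syn_fhat fhat_edge_syn)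

end

text \<open>The expansion is given in two senses: unordered summation at each point, and convergence
  in the graph norm along symmetric windows. Linearity and bijectivity of \<open>fhat\<close>
  together express the isomorphism.\<close>

theorem theorem1p2:
  fixes q :: "real \<Rightarrow> real" and m k :: nat and lam :: real
  assumes hq: "L2_01 q"
    and hk: "k < 2 * m + 1"
    and hlam: "lam \<in> sigma_D q"
  shows "(\<forall>f \<in> eigsp q m k lam. \<forall>n j. f n j 0 = 0 \<and> f n j 1 = 0)
    \<and> (\<forall>n. psi q m k lam n \<in> eigsp q m k lam)
    \<and> (\<forall>f \<in> eigsp q m k lam.
          fhat q m k lam f \<in> l2Z
        \<and> (\<forall>p j x. ((\<lambda>n. fhat q m k lam f n * psi q m k lam n p j x) has_sum f p j x) UNIV)
        \<and> ((\<lambda>M::nat. \<Sum>\<^sub>\<infinity>(p, j). LINT x:{0..1}|lborel.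
              (cmod (f p j x - (\<Sum>n\<in>{- int M..int M}. fhat q m k lam f n * psi q m k lam n p j x)))^2)
            \<longlonglongrightarrow> 0))
    \<and> (\<forall>f \<in> eigsp q m k lam. \<forall>g \<in> eigsp q m k lam. \<forall>a b :: complex.
          fhat q m k lam (\<lambda>n j x. a * f n j x + b * g n j x)
            = (\<lambda>n. a * fhat q m k lam f n + b * fhat q m k lam g n))
    \<and> bij_betw (fhat q m k lam) (eigsp q m k lam) l2Z"
proof -
  interpret dirichlet q m k lam using hq hlam by unfold_locales
  show ?thesis
  proof (intro conjI ballI allI)
    fix f assume f: "f \<in> eigsp q m k lam"
    show "f n j 0 = 0" "f n j 1 = 0" for n j
      using f by (rule eigsp_vanishes_at_vertices)+
    show "fhat q m k lam f \<in> l2Z" using f by (rule fhat_in_l2Z)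
    show "((\<lambda>n. fhat q m k lam f n * psi q m k lam n p j x) has_sum f p j x) UNIV" for p j x
      using psi_expansion_has_sum[of "fhat q m k lam f" p j x] by (simp add: edge_syn_fhat[OF f])
    show "(\<lambda>M::nat. \<Sum>\<^sub>\<infinity>(p, j). LINT x:{0..1}|lborel.
        (cmod (f p j x - (\<Sum>n\<in>{- int M..int M}. fhat q m k lam f n * psi q m k lam n p j x)))^2) \<longlonglongrightarrow> 0"
      using psi_expansion_tendsto[OF fhat_in_l2Z[OF f]] by (simp add: edge_syn_fhat[OF f])
  qed (rule psi_eigsp fhat_linear bij_betw_fhat; assumption)+
qed

end
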